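(* There exist an absolute constant $C>0$ and, for each $n\ge 1$, a constant $C_n>0$ depending only on $n$ such that the following holds. Let $p(\cdot), q(\cdot), 1/\alpha(\cdot)\in \mathcal{P}(\mathbb{R}^n)$ be such that $1<p(\cdot)\leq q(\cdot)<\infty$. Then $$[1]_{A_{p(\cdot),q(\cdot)}^{\alpha(\cdot)}(\mathbb{R}^n)} \le C\, \| M^{\alpha(\cdot)}\|_{L^{p(\cdot)}(\mathbb{R}^n)\to L^{q(\cdot)}(\mathbb{R}^n)}$$ and $$\| M^{\alpha(\cdot)}\|_{L^{p(\cdot)}(\mathbb{R}^n)\to L^{q(\cdot)}(\mathbb{R}^n)} \le C_n\, [1]_{A_{p(\cdot),q(\cdot)}^{\alpha(\cdot)}(\mathbb{R}^n)} \big([1]_{A_{1/\alpha(\cdot)}(\mathbb{R}^n)}\big)^3 \, \|M\|_{ L^{q'(\cdot)}(\mathbb{R}^n)\to L^{q'(\cdot)}(\mathbb{R}^n)}\, \|M\|_{ L^{p(\cdot)}(\mathbb{R}^n)\to L^{p(\cdot)}(\mathbb{R}^n)}.$$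
   Context: $\mathcal{P}(\mathbb{R}^n)$ is the set of measurable functions $p(\cdot):\mathbb{R}^n\to[1,\infty]$ (Lebesgue measure); pointwise relations between exponents are understood almost everywhere. With $1/\infty=0$ and $1/0=\infty$, the condition $1/\alpha(\cdot)\in\mathcal P(\mathbb R^n)$ means that $\alpha:\mathbb{R}^n\to[0,1]$ is measurable. The conjugate exponent is given by $\frac1{p(\cdot)}+\frac1{p'(\cdot)}=1$. The norm of $L^{p(\cdot)}(\mathbb R^n)$ is $\|f\|_{L^{p(\cdot)}}=\inf\{\lambda>0:\rho_{p(\cdot)}(f/\lambda)\le1\}$, where $\rho_{p(\cdot)}(f)=\int_{\{p(\cdot)<\infty\}}|f(x)|^{p(x)}\,dx+\|f\|_{L^\infty(\{p(\cdot)=\infty\})}$. For a ball $B$, $\langle\alpha\rangle_B=\frac1{|B|}\int_B\alpha$. The operators are $$M^{\alpha(\cdot)}f(x)=\sup_{B}\frac{1_B(x)}{|B|^{1-\langle\alpha\rangle_B}}\int_B|f(y)|\,dy,\qquad Mf(x)=\sup_B\frac{1_B(x)}{|B|}\int_B|f(y)|\,dy,$$ with suprema over all balls $B\subset\mathbb R^n$. The Muckenhoupt type quantities are, with suprema over all balls, $$[1]_{A_{s(\cdot)}(\mathbb R^n)}=\sup_B\frac{\|1_B\|_{L^{s(\cdot)}}\|1_B\|_{L^{s'(\cdot)}}}{|B|},\qquad [1]_{A_{p(\cdot),q(\cdot)}^{\alpha(\cdot)}(\mathbb R^n)}=\sup_B\frac{\|1_B\|_{L^{q(\cdot)}}\|1_B\|_{L^{p'(\cdot)}}}{|B|^{1-\langle\alpha\rangle_B}}.$$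 All quantities may be $+\infty$. $\|T\|_{Z\to Y}$ is the smallest $C\in[0,\infty]$ with $\|Tf\|_Y\le C\|f\|_Z$ for all $f\in Z$. *)

theory Defs
  imports "HOL-Probability.Essential_Supremum"
begin

text \<open>
  The dimension \<open>n\<close> is quantified inside the theorem (after an absolute constant), so it cannot be
  a type: points of \<open>n\<close>-dimensional space are the elements of \<open>PiE {..<n} (\<lambda>_. UNIV)\<close>, i.e.
  functions \<open>nat \<Rightarrow> real\<close> that are \<open>undefined\<close> outside \<open>{..<n}\<close>. The completion of the product
  measure is Lebesgue measure on all Lebesgue measurable sets.
\<close>

definition leb :: "nat \<Rightarrow> (nat \<Rightarrow> real) measure" where
  "leb n = completion (PiM {..<n} (\<lambda>_. lborel))"

definition eucl_ball :: "nat \<Rightarrow> (nat \<Rightarrow> real) \<Rightarrow> real \<Rightarrow> (nat \<Rightarrow> real) set" where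
  "eucl_ball n c r = {x \<in> space (leb n). sqrt (\<Sum>i<n. (x i - c i)\<^sup>2) < r}"

definition balls :: "nat \<Rightarrow> (nat \<Rightarrow> real) set set" where
  "balls n = {eucl_ball n c r | c r. c \<in> space (leb n) \<and> 0 < r}"

definition exponents :: "nat \<Rightarrow> ((nat \<Rightarrow> real) \<Rightarrow> ennreal) set" where
  "exponents n = {p \<in> borel_measurable (leb n). \<forall>x \<in> space (leb n). 1 \<le> p x}"

text \<open>
  In \<^typ>\<open>ennreal\<close> one has \<open>1 / 0 = \<infinity>\<close> and \<open>1 / \<infinity> = 0\<close>, and subtraction is truncated,
  which is harmless here since \<open>1 / p x \<le> 1\<close> for exponents.
\<close>

definition conj_exp :: "((nat \<Rightarrow> real) \<Rightarrow> ennreal) \<Rightarrow> (nat \<Rightarrow> real) \<Rightarrow> ennreal" where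
  "conj_exp p = (\<lambda>x. 1 / (1 - 1 / p x))"

text \<open>\<open>t\<close> to the power \<open>r\<close> for \<open>r > 0\<close>, with \<open>\<infinity>\<close> to the power \<open>r\<close> equal to \<open>\<infinity>\<close>.\<close>

definition ennpowr :: "ennreal \<Rightarrow> real \<Rightarrow> ennreal" where
  "ennpowr t r = (if t = \<infinity> then \<infinity> else ennreal (enn2real t powr r))"

text \<open>
  The modular and the norm depend only on the absolute value of a function, which is their
  argument here; values in \<^typ>\<open>ennreal\<close> are needed because maximal functions may be infinite.
\<close>

definition modular :: "nat \<Rightarrow> ((nat \<Rightarrow> real) \<Rightarrow> ennreal) \<Rightarrow> ((nat \<Rightarrow> real) \<Rightarrow> ennreal) \<Rightarrow> ennreal" where
  "modular n p g =
     (\<integral>\<^sup>+x\<in>{x. p x < \<infinity>}. ennpowr (g x) (enn2real (p x)) \<partial>leb n)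
     + esssup (restrict_space (leb n) {x. p x = \<infinity>}) g"

definition lp_norm :: "nat \<Rightarrow> ((nat \<Rightarrow> real) \<Rightarrow> ennreal) \<Rightarrow> ((nat \<Rightarrow> real) \<Rightarrow> ennreal) \<Rightarrow> ennreal" where
  "lp_norm n p g = Inf {ennreal t | t. 0 < t \<and> modular n p (\<lambda>x. g x / ennreal t) \<le> 1}"

definition lp_space :: "nat \<Rightarrow> ((nat \<Rightarrow> real) \<Rightarrow> ennreal) \<Rightarrow> ((nat \<Rightarrow> real) \<Rightarrow> real) set" where
  "lp_space n p = {f \<in> borel_measurable (leb n). lp_norm n p (\<lambda>x. ennreal \<bar>f x\<bar>) < \<infinity>}"

definition op_norm ::
  "nat \<Rightarrow> ((nat \<Rightarrow> real) \<Rightarrow> ennreal) \<Rightarrow> ((nat \<Rightarrow> real) \<Rightarrow> ennreal) \<Rightarrow>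
    (((nat \<Rightarrow> real) \<Rightarrow> real) \<Rightarrow> (nat \<Rightarrow> real) \<Rightarrow> ennreal) \<Rightarrow> ennreal" where
  "op_norm n p q T =
     Inf {C. \<forall>f \<in> lp_space n p. lp_norm n q (T f) \<le> C * lp_norm n p (\<lambda>x. ennreal \<bar>f x\<bar>)}"

text \<open>Conversion to \<^typ>\<open>real\<close> loses nothing for \<open>\<alpha> \<le> 1\<close>; real exponents are needed for \<open>powr\<close>.\<close>

definition avg :: "nat \<Rightarrow> ((nat \<Rightarrow> real) \<Rightarrow> ennreal) \<Rightarrow> (nat \<Rightarrow> real) set \<Rightarrow> real" where
  "avg n \<alpha> B = enn2real ((\<integral>\<^sup>+x\<in>B. \<alpha> x \<partial>leb n) / emeasure (leb n) B)"

definition frac_maximal ::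
  "nat \<Rightarrow> ((nat \<Rightarrow> real) \<Rightarrow> ennreal) \<Rightarrow> ((nat \<Rightarrow> real) \<Rightarrow> real) \<Rightarrow> (nat \<Rightarrow> real) \<Rightarrow> ennreal" where
  "frac_maximal n \<alpha> f x =
     (SUP B\<in>balls n. indicator B x / ennreal (measure (leb n) B powr (1 - avg n \<alpha> B))
        * (\<integral>\<^sup>+y\<in>B. ennreal \<bar>f y\<bar> \<partial>leb n))"

definition maximal :: "nat \<Rightarrow> ((nat \<Rightarrow> real) \<Rightarrow> real) \<Rightarrow> (nat \<Rightarrow> real) \<Rightarrow> ennreal" where
  "maximal n f x =
     (SUP B\<in>balls n. indicator B x / emeasure (leb n) B * (\<integral>\<^sup>+y\<in>B. ennreal \<bar>f y\<bar> \<partial>leb n))"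

definition A_const :: "nat \<Rightarrow> ((nat \<Rightarrow> real) \<Rightarrow> ennreal) \<Rightarrow> ennreal" where
  "A_const n s =
     (SUP B\<in>balls n. lp_norm n s (indicator B) * lp_norm n (conj_exp s) (indicator B)
        / emeasure (leb n) B)"

definition A_frac_const ::
  "nat \<Rightarrow> ((nat \<Rightarrow> real) \<Rightarrow> ennreal) \<Rightarrow> ((nat \<Rightarrow> real) \<Rightarrow> ennreal) \<Rightarrow>
    ((nat \<Rightarrow> real) \<Rightarrow> ennreal) \<Rightarrow> ennreal" where
  "A_frac_const n p q \<alpha> =
     (SUP B\<in>balls n. lp_norm n q (indicator B) * lp_norm n (conj_exp p) (indicator B)
        / ennreal (measure (leb n) B powr (1 - avg n \<alpha> B)))"

end

theory Submission
  imports Defs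
begin

text \<open>
  Write \<open>f_B\<close> for the mean of \<open>|f|\<close> over a ball \<open>B\<close> and \<open>\<alpha>_B\<close> for the mean of \<open>\<alpha>\<close>. The fractional
  maximal function is then the supremum of \<open>|B| powr \<alpha>_B * f_B\<close> over the balls containing a point.

  The lower bound for its operator norm is norm duality. Near-extremal functions for the norm
  of \<open>1_B\<close> in the dual of \<open>L^p\<close> are explicit (lemma \<open>dual_witness\<close>), and their fractional maximal functions are
  large on \<open>B\<close>.

  For the upper bound one tests against \<open>g\<close> in the dual of \<open>L^q\<close>, which is \<open>dual_witness\<close> again.
  After reduction to finitely many balls, three ideas carry the proof.

  First, sparse domination (lemma \<open>sparse_selection\<close>): up to constants, only balls \<open>Q\<close> with pairwise disjoint
  subsets \<open>E_Q\<close> of comparable measure have to be considered. They are selected by the size of the means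
  \<open>f_B\<close> alone, with a greedy selection of Vitali type on the balls themselves, so no dyadic cubes enter. Replacing
  a ball by a larger selected one changes the factor \<open>|B| powr \<alpha>_B\<close> by at most a
  multiple of the Muckenhoupt constant of \<open>1 / \<alpha>\<close> (lemma \<open>powr_avg_le_A_const\<close>): by Jensen's inequality,
  that constant makes \<open>|B| powr \<alpha>_B\<close> comparable to the norm of \<open>1_B\<close> for the exponent \<open>1 / \<alpha>\<close>, which is monotone in \<open>B\<close>.

  What is left is a sum of terms \<open>|Q| powr \<alpha>_Q * f_Q * g_Q * |Q|\<close>.

  Second, each such term is controlled on \<open>E_Q\<close> (lemma \<open>local_estimate\<close>). Outside a small part of \<open>E_Q\<close>, by Chebyshev's
  inequality, the norms of \<open>1_Q\<close> for the exponents \<open>q\<close> and \<open>p'\<close> are at least of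
  order \<open>|Q| powr (1 / q x)\<close> and \<open>|Q| powr (1 / p' x)\<close>. The condition on \<open>p\<close>, \<open>q\<close>, \<open>\<alpha>\<close> therefore bounds
  \<open>|Q| powr \<alpha>_Q\<close> by \<open>|Q| powr (1 / p x - 1 / q x)\<close>. Also \<open>f_Q powr p x * |Q| \<le> 1\<close> outside a small set, since the maximal function
  of \<open>f\<close> has small modular. As \<open>p x \<le> q x\<close>, this gives
  \<open>|Q| powr \<alpha>_Q * f_Q \<lesssim> f_Q powr (p x / q x)\<close> (lemma \<open>pointwise_estimate\<close>).

  Third, Young's inequality turns \<open>f_Q powr (p x / q x) * g_Q\<close> into
  \<open>f_Q powr p x + g_Q powr q' x\<close>. This is at most the sum of the powers of the maximal functions of \<open>f\<close>
  and \<open>g\<close>. The sets \<open>E_Q\<close> being disjoint, the whole sum is bounded by the two modulars, and these are controlled by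
  the norms of the maximal operator on \<open>L^p\<close> and on the dual of \<open>L^q\<close>.
\<close>

section \<open>Euclidean balls\<close>

definition edist :: "nat \<Rightarrow> (nat \<Rightarrow> real) \<Rightarrow> (nat \<Rightarrow> real) \<Rightarrow> real" where
  "edist n x y = L2_set (\<lambda>i. x i - y i) {..<n}"

lemma edist_self [simp]: "edist n x x = 0"
  by (simp add: edist_def L2_set_def)

lemma edist_commute: "edist n x y = edist n y x"
  by (simp add: edist_def L2_set_def power2_commute)

lemma edist_triangle: "edist n x z \<le> edist n x y + edist n y z"
  using L2_set_triangle_ineq[of "\<lambda>i. x i - y i" "\<lambda>i. y i - z i" "{..<n}"]
  by (simp add: edist_def)

lemma space_leb: "space (leb n) = PiE {..<n} (\<lambda>_. UNIV)"
  by (simp add: leb_def space_PiM)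

lemma eucl_ball_eq: "eucl_ball n c r = {x \<in> space (leb n). edist n x c < r}"
  by (simp add: eucl_ball_def edist_def L2_set_def)

lemma eucl_ball_sets [measurable, simp]: "eucl_ball n c r \<in> sets (leb n)"
proof -
  have "{x \<in> space (PiM {..<n} (\<lambda>_. lborel)). sqrt (\<Sum>i<n. (x i - c i)\<^sup>2) < r}
      \<in> sets (PiM {..<n} (\<lambda>_. lborel :: real measure))"
    by measurable
  then show ?thesis
    by (auto simp: eucl_ball_def leb_def)
qed

lemma ballsE:
  assumes "B \<in> balls n"
  obtains c r where "B = eucl_ball n c r" "c \<in> space (leb n)" "0 < r"
  using assms by (auto simp: balls_def)

lemma ballsI: "c \<in> space (leb n) \<Longrightarrow> 0 < r \<Longrightarrow> eucl_ball n c r \<in> balls n"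
  by (auto simp: balls_def)

lemma balls_sets [simp]: "B \<in> balls n \<Longrightarrow> B \<in> sets (leb n)"
  by (auto elim!: ballsE)

lemma eucl_ball_subset:
  assumes "edist n c c' + r \<le> r'"
  shows "eucl_ball n c r \<subseteq> eucl_ball n c' r'"
proof
  fix x assume "x \<in> eucl_ball n c r"
  then show "x \<in> eucl_ball n c' r'"
    using edist_triangle[of n x c' c] assms by (simp add: eucl_ball_eq)
qed

lemma emeasure_box:
  fixes n :: nat and c :: "nat \<Rightarrow> real" and a :: real
  assumes "0 \<le> a"
  defines "Q \<equiv> PiE {..<n} (\<lambda>i. {c i - a<..<c i + a})"
  shows "Q \<in> sets (leb n)" "emeasure (leb n) Q = ennreal ((2 * a) ^ n)"
proof -
  interpret product_sigma_finite "\<lambda>_::nat. lborel :: real measure" ..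
  have Q: "Q \<in> sets (PiM {..<n} (\<lambda>_. lborel))"
    unfolding Q_def by (intro sets_PiM_I_finite) auto
  then show "Q \<in> sets (leb n)"
    by (auto simp: leb_def)
  have "emeasure (leb n) Q = emeasure (PiM {..<n} (\<lambda>_. lborel)) Q"
    using Q by (simp add: leb_def)
  also have "\<dots> = (\<Prod>i<n. emeasure lborel {c i - a<..<c i + a})"
    unfolding Q_def by (rule emeasure_PiM) auto
  also have "\<dots> = ennreal ((2 * a) ^ n)"
    using \<open>0 \<le> a\<close> by (simp add: ennreal_power)
  finally show "emeasure (leb n) Q = ennreal ((2 * a) ^ n)" .
qed

text \<open>
  A ball lies between two cubes with the same centre. This is all the geometry of Lebesgue measure
  that is used: it gives doubling, and that the measure of a ball tends to infinity with its radius.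
\<close>

lemma emeasure_eucl_ball_bounds:
  assumes "n \<ge> 1" "r > 0"
  shows "emeasure (leb n) (eucl_ball n c r) \<le> ennreal ((2 * r) ^ n)"
    and "ennreal ((2 * (r / sqrt n)) ^ n) \<le> emeasure (leb n) (eucl_ball n c r)"
proof -
  let ?Q = "\<lambda>a. PiE {..<n} (\<lambda>i. {c i - a<..<c i + a})"
  have "eucl_ball n c r \<subseteq> ?Q r"
  proof
    fix x assume x: "x \<in> eucl_ball n c r"
    have "\<bar>x i - c i\<bar> < r" if "i < n" for i
      using member_le_L2_set[of "{..<n}" i "\<lambda>i. \<bar>x i - c i\<bar>"] that x
      by (simp add: eucl_ball_eq edist_def L2_set_def)
    then have "c i - r < x i \<and> x i < c i + r" if "i < n" for i
      using that by (simp add: abs_less_iff algebra_simps)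
    then show "x \<in> ?Q r"
      using x by (simp add: eucl_ball_eq space_leb PiE_iff)
  qed
  then show "emeasure (leb n) (eucl_ball n c r) \<le> ennreal ((2 * r) ^ n)"
    using emeasure_mono[of "eucl_ball n c r" "?Q r" "leb n"] emeasure_box[of r n c] assms by simp
  let ?a = "r / sqrt n"
  have "?Q ?a \<subseteq> eucl_ball n c r"
  proof
    fix x assume x: "x \<in> ?Q ?a"
    have "(\<Sum>i<n. (x i - c i)\<^sup>2) < (\<Sum>i<n. ?a\<^sup>2)"
    proof (rule sum_strict_mono)
      fix i assume "i \<in> {..<n}"
      with x have "c i - ?a < x i" "x i < c i + ?a"
        by (auto simp: PiE_iff)
      then have "\<bar>x i - c i\<bar> < \<bar>?a\<bar>"
        by linarith
      then show "(x i - c i)\<^sup>2 < ?a\<^sup>2"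
        using power_strict_mono[of "\<bar>x i - c i\<bar>" "\<bar>?a\<bar>" 2] unfolding power2_abs by simp
    qed (use assms in \<open>auto simp: lessThan_empty_iff\<close>)
    also have "\<dots> = r\<^sup>2"
      using assms by (simp add: power_divide)
    finally have "sqrt (\<Sum>i<n. (x i - c i)\<^sup>2) < r"
      using assms by (simp add: real_less_lsqrt)
    then show "x \<in> eucl_ball n c r"
      using x by (auto simp: eucl_ball_def space_leb PiE_iff)
  qed
  then show "ennreal ((2 * ?a) ^ n) \<le> emeasure (leb n) (eucl_ball n c r)"
    using emeasure_mono[of "?Q ?a" "eucl_ball n c r" "leb n"] emeasure_box[of ?a n c] assms by simp
qed

text \<open>
  The ratio of the volumes of the cube of side \<open>4 * r\<close> around a ball of radius \<open>2 * r\<close> and of the cube of side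
  \<open>2 * r / sqrt n\<close> inside the ball of radius \<open>r\<close>.
\<close>

definition doubling :: "nat \<Rightarrow> real" where
  "doubling n = (2 * sqrt n) ^ n"

lemma doubling_ge_1: "n \<ge> 1 \<Longrightarrow> doubling n \<ge> 1"
  unfolding doubling_def
proof (rule one_le_power)
  assume "n \<ge> 1"
  then have "1 \<le> sqrt n" by simp
  then show "1 \<le> 2 * sqrt n" by linarith
qed

lemma emeasure_ball_finite [simp]:
  assumes "n \<ge> 1" "B \<in> balls n"
  shows "emeasure (leb n) B < \<infinity>" "emeasure (leb n) B < top" "emeasure (leb n) B \<noteq> top"
proof -
  show *: "emeasure (leb n) B < \<infinity>"
  proof -
    obtain c r where "B = eucl_ball n c r" "0 < r"
      using assms(2) by (rule ballsE)
    then have "emeasure (leb n) B \<le> ennreal ((2 * r) ^ n)"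
      using emeasure_eucl_ball_bounds(1)[OF assms(1)] by blast
    then show ?thesis
      by (rule le_less_trans) simp
  qed
  then show "emeasure (leb n) B < top" "emeasure (leb n) B \<noteq> top" by auto
qed

lemma emeasure_ball_eq_measure:
  "n \<ge> 1 \<Longrightarrow> B \<in> balls n \<Longrightarrow> emeasure (leb n) B = ennreal (measure (leb n) B)"
  by (intro emeasure_eq_ennreal_measure) simp

lemma measure_eucl_ball_bounds:
  assumes "n \<ge> 1" "r > 0" "c \<in> space (leb n)"
  shows "measure (leb n) (eucl_ball n c r) \<le> (2 * r) ^ n"
    and "(2 * (r / sqrt n)) ^ n \<le> measure (leb n) (eucl_ball n c r)"
  using emeasure_eucl_ball_bounds[OF assms(1,2), of c] assms(2)
  by (simp_all add: emeasure_ball_eq_measure[OF assms(1) ballsI[OF assms(3,2)]])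

lemma measure_ball_pos:
  assumes "n \<ge> 1" "B \<in> balls n"
  shows "measure (leb n) B > 0"
proof -
  obtain c r where B: "B = eucl_ball n c r" "c \<in> space (leb n)" "0 < r"
    using assms(2) by (rule ballsE)
  have "0 < (2 * (r / sqrt n)) ^ n"
    using assms B by simp
  then show ?thesis
    using measure_eucl_ball_bounds(2)[OF assms(1) B(3,2)] unfolding B(1) by linarith
qed

lemma measure_eucl_ball_double:
  assumes "n \<ge> 1" "r > 0" "c \<in> space (leb n)"
  shows "measure (leb n) (eucl_ball n c (2 * r)) \<le> doubling n * measure (leb n) (eucl_ball n c r)"
proof -
  have "measure (leb n) (eucl_ball n c (2 * r)) \<le> (2 * (2 * r)) ^ n"
    using assms by (intro measure_eucl_ball_bounds) auto
  also have "\<dots> = doubling n * (2 * (r / sqrt n)) ^ n"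
    using assms unfolding doubling_def power_mult_distrib[symmetric] by simp
  also have "\<dots> \<le> doubling n * measure (leb n) (eucl_ball n c r)"
    using assms doubling_ge_1[OF assms(1)]
    by (intro mult_left_mono measure_eucl_ball_bounds) auto
  finally show ?thesis .
qed

lemma measure_eucl_ball_quadruple:
  assumes "n \<ge> 1" "r > 0" "c \<in> space (leb n)"
  shows "measure (leb n) (eucl_ball n c (4 * r)) \<le> (doubling n)\<^sup>2 * measure (leb n) (eucl_ball n c r)"
proof -
  have "measure (leb n) (eucl_ball n c (4 * r)) \<le> doubling n * measure (leb n) (eucl_ball n c (2 * r))"
    using measure_eucl_ball_double[of n "2 * r" c] assms by simp
  also have "\<dots> \<le> doubling n * (doubling n * measure (leb n) (eucl_ball n c r))"
    using assms doubling_ge_1[OF assms(1)]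
    by (intro mult_left_mono measure_eucl_ball_double) auto
  finally show ?thesis by (simp add: power2_eq_square)
qed

text \<open>
  The suprema over all balls below are reduced to countable ones by a Lindelof argument: between a
  point of a ball and that ball there is always a ball with rational centre and radius.
\<close>

lemma rational_ball_between:
  assumes "x \<in> eucl_ball n c r"
  obtains y \<rho> where "y \<in> PiE {..<n} (\<lambda>_. \<rat>)" "\<rho> \<in> \<rat>" "x \<in> eucl_ball n y \<rho>"
    "eucl_ball n y \<rho> \<subseteq> eucl_ball n c r"
proof -
  have x: "x \<in> space (leb n)" and d: "edist n x c < r"
    using assms by (auto simp: eucl_ball_eq)
  obtain \<rho> where \<rho>: "\<rho> \<in> \<rat>" "0 < \<rho>" "\<rho> < (r - edist n x c) / 2"
    using Rats_dense_in_real[of 0 "(r - edist n x c) / 2"] d by auto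
  have "\<exists>y\<in>\<rat>. x i - \<rho> / (n + 1) < y \<and> y < x i + \<rho> / (n + 1)" for i
  proof (rule Rats_dense_in_real)
    have "0 < \<rho> / (n + 1)"
      using \<rho>(2) by simp
    then show "x i - \<rho> / (n + 1) < x i + \<rho> / (n + 1)" by linarith
  qed
  then obtain y where y: "\<And>i. y i \<in> \<rat>" "\<And>i. x i - \<rho> / (n + 1) < y i" "\<And>i. y i < x i + \<rho> / (n + 1)"
    by metis
  let ?y = "restrict y {..<n}"
  have "edist n x ?y \<le> (\<Sum>i<n. \<bar>x i - ?y i\<bar>)"
    unfolding edist_def by (rule L2_set_le_sum_abs)
  also have "\<dots> \<le> (\<Sum>i<n. \<rho> / (n + 1))"
  proof (rule sum_mono)
    fix i assume "i \<in> {..<n}"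
    then show "\<bar>x i - ?y i\<bar> \<le> \<rho> / (n + 1)"
      using y(2,3)[of i] by (simp add: abs_le_iff)
  qed
  also have "\<dots> < \<rho>"
    using \<rho>(2) by (simp add: field_simps)
  finally have xy: "edist n x ?y < \<rho>" .
  show ?thesis
  proof
    show "?y \<in> PiE {..<n} (\<lambda>_. \<rat>)" "\<rho> \<in> \<rat>"
      using y \<rho> by auto
    show "x \<in> eucl_ball n ?y \<rho>"
      using x xy by (simp add: eucl_ball_eq)
    show "eucl_ball n ?y \<rho> \<subseteq> eucl_ball n c r"
      using edist_triangle[of n ?y c x] xy \<rho>(3) edist_commute[of n x ?y]
      by (intro eucl_ball_subset) (auto simp: field_simps)
  qed
qed

lemma balls_Lindelof:
  assumes "\<U> \<subseteq> balls n"
  obtains \<V> where "\<V> \<subseteq> \<U>" "countable \<V>" "\<Union>\<V> = \<Union>\<U>"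
proof -
  define R where "R = (\<lambda>(y, \<rho>). eucl_ball n y \<rho>) ` (PiE {..<n} (\<lambda>_. \<rat>) \<times> \<rat>)"
  have R: "countable R"
    unfolding R_def by (intro countable_image countable_SIGMA countable_PiE) (auto simp: countable_rat)
  define R' where "R' = {A \<in> R. \<exists>B\<in>\<U>. A \<subseteq> B}"
  have "\<forall>A\<in>R'. \<exists>B. B \<in> \<U> \<and> A \<subseteq> B"
    by (auto simp: R'_def)
  then obtain pick where pick: "\<And>A. A \<in> R' \<Longrightarrow> pick A \<in> \<U> \<and> A \<subseteq> pick A"
    by metis
  show ?thesis
  proof
    show "pick ` R' \<subseteq> \<U>" using pick by auto
    show "countable (pick ` R')"
      using R by (auto simp: R'_def intro: countable_subset[of _ R])
    show "\<Union>(pick ` R') = \<Union>\<U>"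
    proof
      show "\<Union>\<U> \<subseteq> \<Union>(pick ` R')"
      proof
        fix x assume "x \<in> \<Union>\<U>"
        then obtain B where B: "B \<in> \<U>" "x \<in> B" by auto
        then obtain c r where "B = eucl_ball n c r"
          using assms by (meson ballsE subsetD)
        with B obtain y \<rho> where "y \<in> PiE {..<n} (\<lambda>_. \<rat>)" "\<rho> \<in> \<rat>" "x \<in> eucl_ball n y \<rho>"
            "eucl_ball n y \<rho> \<subseteq> B"
          using rational_ball_between by blast
        moreover from this have "eucl_ball n y \<rho> \<in> R'"
          using B by (auto simp: R'_def R_def)
        ultimately show "x \<in> \<Union>(pick ` R')"
          using pick by blast
      qed
    qed (use pick in auto)
  qed
qed

text \<open>
  Only the superlevel sets matter: for each rational \<open>t\<close> the balls with \<open>w B > t\<close> can be thinned to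
  countably many with the same union.
\<close>

lemma SUP_balls_countable:
  fixes w :: "(nat \<Rightarrow> real) set \<Rightarrow> ennreal"
  obtains \<V> where "\<V> \<subseteq> balls n" "countable \<V>" "\<V> \<noteq> {}"
    "\<And>x. (SUP B\<in>balls n. w B * indicator B x) = (SUP B\<in>\<V>. w B * indicator B x)"
proof -
  define U where "U q = {B \<in> balls n. ennreal q < w B}" for q :: real
  define V where "V q = (SOME \<V>. \<V> \<subseteq> U q \<and> countable \<V> \<and> \<Union>\<V> = \<Union>(U q))" for q
  have V: "V q \<subseteq> U q" "countable (V q)" "\<Union>(V q) = \<Union>(U q)" for q
  proof -
    have "U q \<subseteq> balls n" by (simp add: U_def)
    then obtain \<V> where "\<V> \<subseteq> U q" "countable \<V>" "\<Union>\<V> = \<Union>(U q)"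
      by (rule balls_Lindelof)
    then have "\<V> \<subseteq> U q \<and> countable \<V> \<and> \<Union>\<V> = \<Union>(U q)"
      by simp
    then have "V q \<subseteq> U q \<and> countable (V q) \<and> \<Union>(V q) = \<Union>(U q)"
      unfolding V_def by (rule someI)
    then show "V q \<subseteq> U q" "countable (V q)" "\<Union>(V q) = \<Union>(U q)"
      by simp_all
  qed
  define B0 where "B0 = eucl_ball n (\<lambda>i\<in>{..<n}. 0) 1"
  have B0: "B0 \<in> balls n"
    unfolding B0_def by (intro ballsI) (auto simp: space_leb)
  let ?V = "insert B0 (\<Union>q\<in>\<rat>. V q)"
  show ?thesis
  proof
    show sub: "?V \<subseteq> balls n" using V(1) B0 by (auto simp: U_def)
    show "countable ?V" using V(2) countable_rat by auto
    show "?V \<noteq> {}" by auto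
    fix x
    show "(SUP B\<in>balls n. w B * indicator B x) = (SUP B\<in>?V. w B * indicator B x)"
    proof (rule antisym)
      show "(SUP B\<in>?V. w B * indicator B x) \<le> (SUP B\<in>balls n. w B * indicator B x)"
        using sub by (intro SUP_subset_mono) auto
      show "(SUP B\<in>balls n. w B * indicator B x) \<le> (SUP B\<in>?V. w B * indicator B x)"
      proof (rule dense_le)
        fix t assume "t < (SUP B\<in>balls n. w B * indicator B x)"
        then obtain B where B: "B \<in> balls n" "t < w B * indicator B x"
          by (auto simp: less_SUP_iff)
        then have x: "x \<in> B" and tw: "t < w B"
          by (cases "x \<in> B"; simp)+
        obtain q where q: "q \<in> \<rat>" "t < ennreal q" "ennreal q < w B"
        proof -
          obtain s where ts: "t < s" and sw: "s < w B"
            using tw dense by blast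
          have s_top: "s < top"
            using sw top_greatest by (rule order_less_le_trans)
          have "t < top"
            using ts s_top by (rule order_less_trans)
          with s_top obtain t' s' where "t = ennreal t'" "s = ennreal s'" "0 \<le> t'" "0 \<le> s'"
            by (cases t; cases s) auto
          moreover from calculation ts have "t' < s'" by (simp add: ennreal_less_iff)
          moreover from this obtain q where "q \<in> \<rat>" "t' < q" "q < s'"
            using Rats_dense_in_real by blast
          ultimately show ?thesis
            using that[of q] order_less_trans[OF _ sw, of "ennreal q"] by (simp add: ennreal_less_iff)
        qed
        then have "x \<in> \<Union>(V q)"
          using x B V(3)[of q] by (auto simp: U_def)
        then obtain B' where B': "B' \<in> V q" "x \<in> B'" by auto
        have "t \<le> w B' * indicator B' x"
          using B' V(1)[of q] q(2) by (auto simp: U_def)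
        also have "\<dots> \<le> (SUP B\<in>?V. w B * indicator B x)"
        proof (rule SUP_upper)
          show "B' \<in> ?V" using B'(1) q(1) by blast
        qed
        finally show "t \<le> (SUP B\<in>?V. w B * indicator B x)" .
      qed
    qed
  qed
qed

lemma SUP_balls_measurable:
  "(\<lambda>x. SUP B\<in>balls n. w B * indicator B x :: ennreal) \<in> borel_measurable (leb n)"
proof -
  obtain \<V> where V: "\<V> \<subseteq> balls n" "countable \<V>" "\<V> \<noteq> {}"
    "\<And>x. (SUP B\<in>balls n. w B * indicator B x) = (SUP B\<in>\<V>. w B * indicator B x)"
    by (rule SUP_balls_countable[of n w]) (rule that)
  show ?thesis
    unfolding V(4)
  proof (rule borel_measurable_SUP[OF V(2)])
    fix B assume "B \<in> \<V>"
    then have [measurable]: "B \<in> sets (leb n)"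
      using V(1) by auto
    show "(\<lambda>x. w B * indicator B x) \<in> borel_measurable (leb n)"
      by measurable
  qed
qed

section \<open>The norm of a variable Lebesgue space\<close>

lemma ennpowr_ennreal [simp]: "0 \<le> t \<Longrightarrow> ennpowr (ennreal t) r = ennreal (t powr r)"
  by (simp add: ennpowr_def)

lemma ennpowr_top [simp]: "ennpowr top r = top"
  by (simp add: ennpowr_def)

lemma ennpowr_mono:
  assumes "a \<le> b" "0 \<le> r"
  shows "ennpowr a r \<le> ennpowr b r"
proof (cases b)
  case (real b')
  with assms obtain a' where "a = ennreal a'" "0 \<le> a'" "a' \<le> b'"
    by (cases a) (auto simp: top_unique)
  with real assms show ?thesis
    by (auto intro!: ennreal_leI powr_mono2)
qed simp

text \<open>
  Since \<open>r \<ge> 1\<close>, a factor \<open>c \<le> 1\<close> leaves the power at least linearly. This is how a small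
  factor in front of a function makes its modular small.
\<close>

lemma ennpowr_contract:
  assumes "0 < c" "c \<le> 1" "1 \<le> r"
  shows "ennpowr (ennreal c * t) r \<le> ennreal c * ennpowr t r"
proof (cases t)
  case (real t')
  have "c powr r \<le> c powr 1"
    using assms by (intro powr_mono') auto
  then have "(c * t') powr r \<le> c * t' powr r"
    using assms real by (simp add: powr_mult mult_right_mono)
  then show ?thesis
    using assms real by (simp flip: ennreal_mult)
qed (use assms in \<open>simp add: ennreal_mult_top\<close>)

lemma ennpowr_measurable [measurable (raw)]:
  assumes "f \<in> borel_measurable M" "r \<in> borel_measurable M"
  shows "(\<lambda>x. ennpowr (f x) (r x)) \<in> borel_measurable M"
  using assms unfolding ennpowr_def by measurable

text \<open>
  The hypotheses force \<open>p\<close>, \<open>q\<close> and their conjugates to lie strictly between \<open>1\<close> and \<open>\<infinity>\<close> almost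
  everywhere, so that all four are exponents of this kind, and the essential supremum in the
  modular is taken over a null set.
\<close>

definition proper_exponent :: "nat \<Rightarrow> ((nat \<Rightarrow> real) \<Rightarrow> ennreal) \<Rightarrow> bool" where
  "proper_exponent n s \<longleftrightarrow> s \<in> borel_measurable (leb n) \<and> (AE x in leb n. 1 < s x \<and> s x < \<infinity>)"

lemma proper_exponent_measurable [measurable_dest]:
  "proper_exponent n s \<Longrightarrow> s \<in> borel_measurable (leb n)"
  by (simp add: proper_exponent_def)

lemma proper_exponent_AE:
  assumes "proper_exponent n s"
  shows "AE x in leb n. \<exists>S > 1. s x = ennreal S"
proof -
  have "\<exists>S > 1. s x = ennreal S" if "1 < s x \<and> s x < \<infinity>" for x
    using that by (cases "s x") auto
  with assms show ?thesis
    unfolding proper_exponent_def by (auto elim: eventually_mono)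
qed

lemma conj_exp_ennreal:
  assumes "1 < S" "s x = ennreal S"
  shows "conj_exp s x = ennreal (S / (S - 1))"
proof -
  have "1 / ennreal S = ennreal (1 / S)"
    using assms divide_ennreal[of 1 S] by simp
  then have "1 - 1 / ennreal S = ennreal (1 - 1 / S)"
    using assms ennreal_minus[of "1 / S" 1] by simp
  then have "conj_exp s x = ennreal 1 / ennreal (1 - 1 / S)"
    using assms by (simp add: conj_exp_def)
  also have "\<dots> = ennreal (1 / (1 - 1 / S))"
    using assms by (intro divide_ennreal) auto
  also have "1 / (1 - 1 / S) = S / (S - 1)"
    using assms by (simp add: field_simps)
  finally show ?thesis .
qed

lemma proper_exponent_conj:
  assumes "proper_exponent n s"
  shows "proper_exponent n (conj_exp s)"
proof -
  note [measurable] = proper_exponent_measurable[OF assms]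
  have "1 < conj_exp s x \<and> conj_exp s x < \<infinity>" if "\<exists>S > 1. s x = ennreal S" for x
    using that by (auto simp: conj_exp_ennreal field_simps)
  then show ?thesis
    using proper_exponent_AE[OF assms] unfolding proper_exponent_def
    by (auto simp: conj_exp_def[abs_def] elim: eventually_mono)
qed

lemma conj_exp_conj_exp:
  assumes "1 \<le> s x"
  shows "conj_exp (conj_exp s) x = s x"
proof -
  have "1 / s x \<le> 1"
    using assms divide_le_posI_ennreal[of "s x" 1 1] by (simp add: less_le_trans[OF zero_less_one])
  then have "1 - (1 - 1 / s x) = 1 / s x"
    by (intro diff_diff_ennreal) auto
  then show ?thesis
    by (simp add: conj_exp_def)
qed

lemma modular_proper:
  assumes "proper_exponent n s" "g \<in> borel_measurable (leb n)"
  shows "modular n s g = (\<integral>\<^sup>+x. ennpowr (g x) (enn2real (s x)) \<partial>leb n)"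
proof -
  note [measurable] = proper_exponent_measurable[OF assms(1)] assms(2)
  have fin: "AE x in leb n. s x < \<infinity>"
    using assms by (auto simp: proper_exponent_def)
  have "{x. s x = \<infinity>} \<inter> space (leb n) = {x \<in> space (leb n). s x = \<infinity>}"
    by auto
  then have "{x. s x = \<infinity>} \<inter> space (leb n) \<in> sets (leb n)"
    by simp
  then have "AE x in restrict_space (leb n) {x. s x = \<infinity>}. g x \<le> 0"
    using fin by (auto simp: AE_restrict_space_iff)
  then have "esssup (restrict_space (leb n) {x. s x = \<infinity>}) g \<le> 0"
    by (intro esssup_I measurable_restrict_space1) auto
  moreover have "(\<integral>\<^sup>+x\<in>{x. s x < \<infinity>}. ennpowr (g x) (enn2real (s x)) \<partial>leb n)
      = (\<integral>\<^sup>+x. ennpowr (g x) (enn2real (s x)) \<partial>leb n)"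
    using fin by (intro nn_integral_cong_AE) auto
  ultimately show ?thesis
    by (simp add: modular_def)
qed

lemma modular_mono:
  assumes "proper_exponent n s" "f \<in> borel_measurable (leb n)" "g \<in> borel_measurable (leb n)"
    and "\<And>x. x \<in> space (leb n) \<Longrightarrow> f x \<le> g x"
  shows "modular n s f \<le> modular n s g"
  using assms by (auto simp: modular_proper intro!: nn_integral_mono ennpowr_mono)

lemma modular_contract:
  assumes "proper_exponent n s" "f \<in> borel_measurable (leb n)" "0 < c" "c \<le> 1"
  shows "modular n s (\<lambda>x. ennreal c * f x) \<le> ennreal c * modular n s f"
proof -
  note [measurable] = proper_exponent_measurable[OF assms(1)] assms(2)
  have "modular n s (\<lambda>x. ennreal c * f x)
      = (\<integral>\<^sup>+x. ennpowr (ennreal c * f x) (enn2real (s x)) \<partial>leb n)"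
    using assms by (intro modular_proper) auto
  also have "\<dots> \<le> (\<integral>\<^sup>+x. ennreal c * ennpowr (f x) (enn2real (s x)) \<partial>leb n)"
    using proper_exponent_AE[OF assms(1)] assms(3,4)
    by (intro nn_integral_mono_AE) (auto elim!: eventually_mono intro!: ennpowr_contract)
  also have "\<dots> = ennreal c * modular n s f"
    using assms by (simp add: nn_integral_cmult modular_proper)
  finally show ?thesis .
qed

lemma lp_norm_le:
  "0 < t \<Longrightarrow> modular n s (\<lambda>x. g x / ennreal t) \<le> 1 \<Longrightarrow> lp_norm n s g \<le> ennreal t"
  unfolding lp_norm_def by (rule Inf_lower) auto

lemma le_lp_normI:
  assumes "\<And>t. 0 < t \<Longrightarrow> modular n s (\<lambda>x. g x / ennreal t) \<le> 1 \<Longrightarrow> c \<le> ennreal t"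
  shows "c \<le> lp_norm n s g"
  unfolding lp_norm_def by (rule Inf_greatest) (use assms in auto)

lemma modular_le_1:
  assumes "proper_exponent n s" "g \<in> borel_measurable (leb n)" "lp_norm n s g < ennreal t"
  shows "modular n s (\<lambda>x. g x / ennreal t) \<le> 1"
proof -
  obtain t' where t': "0 < t'" "ennreal t' < ennreal t" "modular n s (\<lambda>x. g x / ennreal t') \<le> 1"
    using assms(3) unfolding lp_norm_def by (auto simp: Inf_less_iff)
  have "t' < t"
    using t'(1,2) by (simp add: ennreal_less_iff)
  then have "ennreal (inverse t) \<le> ennreal (inverse t')"
    using t'(1) by (intro ennreal_leI le_imp_inverse_le) auto
  then have "modular n s (\<lambda>x. g x / ennreal t) \<le> modular n s (\<lambda>x. g x / ennreal t')"
    using assms(2) by (intro modular_mono assms) (use t'(1) \<open>t' < t\<close> in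
      \<open>auto simp: divide_ennreal_def inverse_ennreal intro!: mult_left_mono\<close>)
  with t'(3) show ?thesis by simp
qed

lemma lp_norm_mono:
  assumes "proper_exponent n s" "f \<in> borel_measurable (leb n)" "g \<in> borel_measurable (leb n)"
    and "\<And>x. x \<in> space (leb n) \<Longrightarrow> f x \<le> g x"
  shows "lp_norm n s f \<le> lp_norm n s g"
proof (rule le_lp_normI)
  fix t :: real assume t: "0 < t" "modular n s (\<lambda>x. g x / ennreal t) \<le> 1"
  have "modular n s (\<lambda>x. f x / ennreal t) \<le> modular n s (\<lambda>x. g x / ennreal t)"
    using assms by (intro modular_mono) (auto intro: divide_right_mono_ennreal)
  with t show "lp_norm n s f \<le> ennreal t"
    by (intro lp_norm_le) auto
qed

lemma lp_norm_scale:
  assumes "0 < c"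
  shows "lp_norm n s (\<lambda>x. ennreal c * g x) = ennreal c * lp_norm n s g"
proof -
  have *: "lp_norm n s (\<lambda>x. ennreal c * g x) \<le> ennreal c * lp_norm n s g"
    if "0 < c" for c and g :: "(nat \<Rightarrow> real) \<Rightarrow> ennreal"
  proof -
    have "lp_norm n s (\<lambda>x. ennreal c * g x) / ennreal c \<le> lp_norm n s g"
    proof (rule le_lp_normI)
      fix t :: real assume t: "0 < t" "modular n s (\<lambda>x. g x / ennreal t) \<le> 1"
      have "ennreal c * g x / ennreal (c * t) = g x / ennreal t" for x
        using \<open>0 < c\<close> t divide_mult_eq[of "ennreal c" "g x" "ennreal t"]
        by (simp add: ennreal_mult mult.commute)
      with t \<open>0 < c\<close> have "lp_norm n s (\<lambda>x. ennreal c * g x) \<le> ennreal (c * t)"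
        by (intro lp_norm_le) auto
      then show "lp_norm n s (\<lambda>x. ennreal c * g x) / ennreal c \<le> ennreal t"
        using \<open>0 < c\<close> t by (intro divide_le_posI_ennreal) (auto simp: ennreal_mult)
    qed
    then have "ennreal c * (lp_norm n s (\<lambda>x. ennreal c * g x) / ennreal c) \<le> ennreal c * lp_norm n s g"
      by (rule mult_left_mono) simp
    moreover have "ennreal c * (X / ennreal c) = X" for X
      using \<open>0 < c\<close> ennreal_mult_divide_eq[of "ennreal c" X]
      by (simp add: ennreal_times_divide mult.commute[of _ X])
    ultimately show ?thesis by simp
  qed
  have "g = (\<lambda>x. ennreal (1 / c) * (ennreal c * g x))"
    using assms by (auto simp: fun_eq_iff simp flip: mult.assoc ennreal_mult)
  then have "lp_norm n s g \<le> ennreal (1 / c) * lp_norm n s (\<lambda>x. ennreal c * g x)"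
    using *[of "1 / c" "\<lambda>x. ennreal c * g x"] assms by simp
  then have "ennreal c * lp_norm n s g
      \<le> ennreal c * (ennreal (1 / c) * lp_norm n s (\<lambda>x. ennreal c * g x))"
    by (rule mult_left_mono) simp
  then have "ennreal c * lp_norm n s g \<le> lp_norm n s (\<lambda>x. ennreal c * g x)"
    using assms by (simp flip: mult.assoc ennreal_mult)
  with *[OF assms] show ?thesis
    by (rule antisym)
qed

text \<open>
  The exponent may be unbounded; \<open>t = max 1 |B|\<close> works because \<open>t\<close> to any power above \<open>1\<close> is at
  least \<open>t\<close>.
\<close>

lemma lp_norm_indicator_finite:
  assumes "proper_exponent n s" "B \<in> sets (leb n)" "emeasure (leb n) B < \<infinity>"
  shows "lp_norm n s (indicator B) < \<infinity>"
proof -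
  note [measurable] = proper_exponent_measurable[OF assms(1)] assms(2)
  define t where "t = max 1 (measure (leb n) B)"
  have t: "1 \<le> t" by (simp add: t_def)
  have eq: "indicator B x / ennreal t = ennreal (1 / t) * indicator B x" for x
    using t divide_ennreal[of 1 t] by (auto simp: indicator_def)
  have "modular n s (\<lambda>x. indicator B x / ennreal t) \<le> ennreal (1 / t) * modular n s (indicator B)"
    unfolding eq using t assms by (intro modular_contract) auto
  also have "modular n s (indicator B) = (\<integral>\<^sup>+x. indicator B x \<partial>leb n)"
  proof -
    have "modular n s (indicator B) = (\<integral>\<^sup>+x. ennpowr (indicator B x) (enn2real (s x)) \<partial>leb n)"
      using assms by (intro modular_proper) auto
    also have "\<dots> = (\<integral>\<^sup>+x. indicator B x \<partial>leb n)"
      using proper_exponent_AE[OF assms(1)]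
      by (intro nn_integral_cong_AE) (auto simp: ennpowr_def indicator_def elim!: eventually_mono)
    finally show ?thesis .
  qed
  also have "\<dots> = ennreal (measure (leb n) B)"
    using assms by (simp add: emeasure_eq_ennreal_measure)
  also have "ennreal (1 / t) * ennreal (measure (leb n) B) \<le> 1"
    using t by (auto simp: t_def simp flip: ennreal_mult)
  finally have "lp_norm n s (indicator B) \<le> ennreal t"
    using t by (intro lp_norm_le) auto
  then show ?thesis
    by (rule le_less_trans) simp
qed

section \<open>Averages and norms of indicators\<close>

lemma integral_avg:
  assumes "n \<ge> 1" "B \<in> balls n" "\<beta> \<in> borel_measurable (leb n)" "(\<integral>\<^sup>+x\<in>B. \<beta> x \<partial>leb n) < \<infinity>"
  shows "(\<integral>\<^sup>+x\<in>B. \<beta> x \<partial>leb n) = ennreal (avg n \<beta> B * measure (leb n) B)"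
proof -
  have W: "emeasure (leb n) B = ennreal (measure (leb n) B)" "0 < measure (leb n) B"
    using assms by (simp_all add: emeasure_ball_eq_measure measure_ball_pos)
  obtain I where I: "(\<integral>\<^sup>+x\<in>B. \<beta> x \<partial>leb n) = ennreal I" "0 \<le> I"
    using assms(4) by (cases "\<integral>\<^sup>+x\<in>B. \<beta> x \<partial>leb n") auto
  then show ?thesis
    using W by (simp add: avg_def divide_ennreal)
qed

text \<open>Jensen's inequality for \<open>t \<mapsto> W powr t\<close>, from the tangent at the mean.\<close>

lemma powr_avg_le_integral:
  assumes "n \<ge> 1" "B \<in> balls n" "\<beta> \<in> borel_measurable (leb n)" "\<And>x. x \<in> space (leb n) \<Longrightarrow> \<beta> x \<le> 1"
    and "0 < w"
  shows "ennreal (w powr avg n \<beta> B * measure (leb n) B)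
    \<le> (\<integral>\<^sup>+x\<in>B. ennreal (w powr enn2real (\<beta> x)) \<partial>leb n)"
proof -
  note [measurable] = assms(3)
  have [measurable]: "B \<in> sets (leb n)" using assms by simp
  let ?W = "measure (leb n) B" and ?a = "avg n \<beta> B"
  define b where "b x = enn2real (\<beta> x)" for x
  have [measurable]: "b \<in> borel_measurable (leb n)"
    unfolding b_def by measurable
  have b: "0 \<le> b x" "b x \<le> 1" "\<beta> x = ennreal (b x)" if "x \<in> space (leb n)" for x
    using assms(4)[OF that] by (cases "\<beta> x"; auto simp: b_def top_unique)+
  have fin: "emeasure (leb n) B < \<infinity>" using assms by simp
  have "(\<integral>\<^sup>+x\<in>B. \<beta> x \<partial>leb n) \<le> (\<integral>\<^sup>+x\<in>B. 1 \<partial>leb n)"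
    using assms by (intro nn_integral_mono) (auto simp: indicator_def)
  also have "\<dots> < \<infinity>" using fin by simp
  finally have "(\<integral>\<^sup>+x\<in>B. \<beta> x \<partial>leb n) = ennreal (?a * ?W)"
    using assms by (intro integral_avg) auto
  also have "(\<integral>\<^sup>+x\<in>B. \<beta> x \<partial>leb n) = (\<integral>\<^sup>+x. ennreal (indicator B x *\<^sub>R b x) \<partial>leb n)"
    using b by (intro nn_integral_cong) (auto simp: indicator_def)
  finally have nn: "(\<integral>\<^sup>+x. ennreal (indicator B x *\<^sub>R b x) \<partial>leb n) = ennreal (?a * ?W)" .
  have ib: "integrable (leb n) (\<lambda>x. indicator B x *\<^sub>R b x)"
    using fin b by (intro integrableI_bounded_set_indicator[where B = 1]) auto
  have mean: "(LINT x|leb n. indicator B x *\<^sub>R b x) = ?a * ?W"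
    using nn b by (subst integral_eq_nn_integral) (auto simp: indicator_def avg_def)
  have ind: "integrable (leb n) (indicator B :: _ \<Rightarrow> real)"
    using fin by (auto simp: integrable_indicator_iff)
  have iw: "integrable (leb n) (\<lambda>x. indicator B x *\<^sub>R w powr b x)"
  proof (rule integrableI_bounded_set_indicator[where B = "max 1 w"])
    have "w powr b x \<le> max 1 w" if "x \<in> space (leb n)" for x
    proof (cases "w \<le> 1")
      case True
      then have "w powr b x \<le> 1"
        using assms(5) b[OF that] powr_mono2[of "b x" w 1] by simp
      then show ?thesis by simp
    next
      case False
      then show ?thesis
        using powr_mono[of "b x" 1 w] b[OF that] by simp
    qed
    then show "AE x in leb n. x \<in> B \<longrightarrow> norm (w powr b x) \<le> max 1 w"
      by auto
  qed (use fin in auto)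
  let ?L = "\<lambda>x. w powr ?a * (1 - ?a * ln w) * indicator B x + w powr ?a * ln w * (indicator B x *\<^sub>R b x)"
  have "(LINT x|leb n. ?L x) \<le> (LINT x|leb n. indicator B x *\<^sub>R w powr b x)"
  proof (rule integral_mono[OF _ iw])
    show "integrable (leb n) ?L"
      using ib ind by (intro Bochner_Integration.integrable_add integrable_mult_right)
    fix x
    have "1 + (b x - ?a) * ln w \<le> exp ((b x - ?a) * ln w)"
      by (rule exp_ge_add_one_self)
    then have "w powr ?a * (1 + (b x - ?a) * ln w) \<le> w powr ?a * w powr (b x - ?a)"
      using assms(5) by (intro mult_left_mono) (auto simp: powr_def)
    also have "\<dots> = w powr b x"
      by (simp flip: powr_add)
    finally show "?L x \<le> indicator B x *\<^sub>R w powr b x"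
      by (auto simp: indicator_def algebra_simps)
  qed
  also have "(LINT x|leb n. ?L x) = w powr ?a * ?W"
  proof -
    have "(LINT x|leb n. ?L x) = w powr ?a * (1 - ?a * ln w) * (LINT x|leb n. indicator B x)
        + w powr ?a * ln w * (LINT x|leb n. indicator B x *\<^sub>R b x)"
      using ib ind
      by (subst Bochner_Integration.integral_add)
         (simp_all only: integrable_mult_right integral_mult_right_zero)
    also have "(LINT x|leb n. indicator B x) = ?W"
      using sets.Int_space_eq2[of B "leb n"] by simp
    finally show ?thesis
      unfolding mean by (simp add: algebra_simps)
  qed
  finally have "ennreal (w powr ?a * ?W) \<le> ennreal (LINT x|leb n. indicator B x *\<^sub>R w powr b x)"
    by (rule ennreal_leI)
  also have "\<dots> = (\<integral>\<^sup>+x. ennreal (indicator B x *\<^sub>R w powr b x) \<partial>leb n)"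
    by (intro nn_integral_eq_integral[symmetric] iw) auto
  also have "\<dots> = (\<integral>\<^sup>+x\<in>B. ennreal (w powr enn2real (\<beta> x)) \<partial>leb n)"
    by (intro nn_integral_cong) (auto simp: indicator_def b_def)
  finally show ?thesis .
qed

text \<open>
  Integrating the pointwise inequality \<open>y powr b \<le> 1 + y\<close>, for \<open>y = W * (1 / t) powr (1 / b)\<close>, bounds
  the mean of \<open>W powr \<beta>\<close> by \<open>2 * t\<close>, and Jensen's inequality bounds it from below. This is the
  general lower bound for norms of indicators: it yields their positivity, and, applied to \<open>\<alpha>\<close> and
  to \<open>1 - \<alpha>\<close>, the comparison of powers of nested balls. Points with \<open>\<beta> x = 0\<close> have infinite exponent
  and are handled by the essential supremum in the modular.
\<close>

lemma powr_avg_le_lp_norm: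
  assumes n: "n \<ge> 1" and B: "B \<in> balls n" and S: "S \<in> sets (leb n)" "B \<subseteq> S"
    and \<beta>: "\<beta> \<in> borel_measurable (leb n)" "\<And>x. x \<in> space (leb n) \<Longrightarrow> \<beta> x \<le> 1"
  shows "ennreal (measure (leb n) B powr avg n \<beta> B) \<le> 2 * lp_norm n (\<lambda>x. 1 / \<beta> x) (indicator S)"
proof -
  note [measurable] = \<beta>(1) S(1)
  have [measurable]: "B \<in> sets (leb n)" using B by simp
  define W where "W = measure (leb n) B"
  have W: "0 < W" "emeasure (leb n) B = ennreal W"
    using n B by (simp_all add: W_def emeasure_ball_eq_measure measure_ball_pos)
  let ?a = "avg n \<beta> B"
  have "ennreal (W powr ?a / 2) \<le> lp_norm n (\<lambda>x. 1 / \<beta> x) (indicator S)"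
  proof (rule le_lp_normI)
    fix t :: real assume t: "0 < t" and mod: "modular n (\<lambda>x. 1 / \<beta> x) (\<lambda>x. indicator S x / ennreal t) \<le> 1"
    let ?I = "{x. 1 / \<beta> x = \<infinity>}"
    define E where "E x = ennpowr (indicator S x / ennreal t) (enn2real (1 / \<beta> x))
        * indicator {x. 1 / \<beta> x < \<infinity>} x" for x
    have [measurable]: "E \<in> borel_measurable (leb n)"
      unfolding E_def by measurable
    have "(\<integral>\<^sup>+x. E x \<partial>leb n) + esssup (restrict_space (leb n) ?I) (\<lambda>x. indicator S x / ennreal t) \<le> 1"
      using mod by (simp add: modular_def E_def)
    then have E: "(\<integral>\<^sup>+x. E x \<partial>leb n) \<le> 1"
      and ess: "esssup (restrict_space (leb n) ?I) (\<lambda>x. indicator S x / ennreal t) \<le> 1"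
      by (rule order_trans[rotated], simp)+
    have "?I \<inter> space (leb n) = {x \<in> space (leb n). 1 / \<beta> x = \<infinity>}"
      by auto
    then have I: "?I \<inter> space (leb n) \<in> sets (leb n)"
      by simp
    have "AE x in restrict_space (leb n) ?I. indicator S x / ennreal t \<le> 1"
      using esssup_AE[of "\<lambda>x. indicator S x / ennreal t" "restrict_space (leb n) ?I"] ess
      by (auto elim!: eventually_mono)
    then have ae: "AE x in leb n. 1 / \<beta> x = \<infinity> \<longrightarrow> indicator S x / ennreal t \<le> 1"
      using I by (simp add: AE_restrict_space_iff)
    have point: "ennreal (W powr enn2real (\<beta> x)) * indicator B x
        \<le> ennreal t * (indicator B x + ennreal W * E x)"
      if x: "x \<in> space (leb n)" and ae_x: "1 / \<beta> x = \<infinity> \<longrightarrow> indicator S x / ennreal t \<le> 1" for x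
    proof (cases "x \<in> B")
      case True
      with S have xS: "x \<in> S" by auto
      obtain b where b: "\<beta> x = ennreal b" "0 \<le> b" "b \<le> 1"
        using \<beta>(2)[OF x] by (cases "\<beta> x") (auto simp: top_unique)
      have inv: "1 / ennreal t = ennreal (1 / t)"
        using t divide_ennreal[of 1 t] by simp
      show ?thesis
      proof (cases "b = 0")
        case True
        then have "1 / ennreal t \<le> 1"
          using ae_x xS b by simp
        then have "1 \<le> t"
          using t inv by simp
        then have "1 \<le> ennreal t" by simp
        then show ?thesis
          using True b W \<open>x \<in> B\<close> by (simp add: distrib_left add_increasing2)
      next
        case False
        with b have b0: "0 < b" by simp
        have sx: "1 / \<beta> x = ennreal (1 / b)"
          using b b0 divide_ennreal[of 1 b] by simp
        have Ex: "E x = ennreal ((1 / t) powr (1 / b))"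
          using xS sx b0 t inv by (simp add: E_def)
        \<comment> \<open>\<open>y\<close> is \<open>W\<close> times the integrand of the modular, and \<open>y powr b = W powr b / t\<close>.\<close>
        define y where "y = W * (1 / t) powr (1 / b)"
        have y: "0 < y" using W t by (simp add: y_def)
        have "y powr b \<le> 1 + y"
        proof (cases "y \<le> 1")
          case True
          then have "y powr b \<le> 1"
            using powr_mono2[of b y 1] y b by simp
          with y show ?thesis by simp
        next
          case False
          then show ?thesis
            using powr_mono[of b 1 y] y b by simp
        qed
        moreover have "y powr b = W powr b / t"
          using W t b0 by (simp add: y_def powr_mult powr_powr powr_divide)
        ultimately have "W powr b \<le> t * (1 + y)"
          using t by (simp add: field_simps)
        then have "ennreal (W powr b) \<le> ennreal (t * (1 + y))"
          by (rule ennreal_leI)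
        also have "\<dots> = ennreal t * (1 + ennreal W * E x)"
          using t y W by (simp add: ennreal_mult Ex y_def)
        finally show ?thesis
          using \<open>x \<in> B\<close> b by simp
      qed
    qed simp
    have "ennreal (W powr ?a * W) \<le> (\<integral>\<^sup>+x\<in>B. ennreal (W powr enn2real (\<beta> x)) \<partial>leb n)"
      using powr_avg_le_integral[OF n B \<beta>, of W] W by (simp add: W_def)
    also have "\<dots> \<le> (\<integral>\<^sup>+x. ennreal t * (indicator B x + ennreal W * E x) \<partial>leb n)"
      using ae point by (intro nn_integral_mono_AE) auto
    also have "\<dots> = ennreal t * (ennreal W + ennreal W * (\<integral>\<^sup>+x. E x \<partial>leb n))"
      by (simp add: nn_integral_cmult nn_integral_add W)
    also have "\<dots> \<le> ennreal t * (ennreal W + ennreal W * 1)"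
      using E by (intro mult_left_mono add_left_mono) auto
    also have "\<dots> = ennreal (2 * t * W)"
      using t W by (simp flip: ennreal_mult ennreal_plus)
    finally have "W powr ?a * W \<le> 2 * t * W"
      using t W by (simp add: ennreal_le_iff)
    then show "ennreal (W powr ?a / 2) \<le> ennreal t"
      using W by (intro ennreal_leI) simp
  qed
  then have "2 * ennreal (W powr ?a / 2) \<le> 2 * lp_norm n (\<lambda>x. 1 / \<beta> x) (indicator S)"
    by (rule mult_left_mono) simp
  moreover have "2 * ennreal (W powr ?a / 2) = ennreal (W powr ?a)"
    by (simp flip: ennreal_mult'' ennreal_numeral)
  ultimately show ?thesis
    by (simp add: W_def)
qed

lemma lp_norm_indicator_pos:
  assumes "n \<ge> 1" "s \<in> exponents n" "B \<in> balls n"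
  shows "0 < lp_norm n s (indicator B)"
proof -
  have s: "s \<in> borel_measurable (leb n)" "\<And>x. x \<in> space (leb n) \<Longrightarrow> 1 \<le> s x"
    using assms by (auto simp: exponents_def)
  have "1 / s x \<le> 1" if "x \<in> space (leb n)" for x
    using s(2)[OF that] by (intro divide_le_posI_ennreal) (auto simp: less_le_trans[OF zero_less_one])
  then have "ennreal (measure (leb n) B powr avg n (\<lambda>x. 1 / s x) B)
      \<le> 2 * lp_norm n (\<lambda>x. 1 / (1 / s x)) (indicator B)"
    using assms s by (intro powr_avg_le_lp_norm) auto
  moreover have "0 < ennreal (measure (leb n) B powr avg n (\<lambda>x. 1 / s x) B)"
    using measure_ball_pos[OF assms(1,3)] by simp
  ultimately have "0 < 2 * lp_norm n s (indicator B)"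
    unfolding one_divide_one_divide_ennreal by (rule less_le_trans[rotated])
  then show ?thesis
    by (cases "lp_norm n s (indicator B) = 0") (auto simp: zero_less_iff_neq_zero)
qed

section \<open>Norm duality\<close>

text \<open>
  The half of norm duality that needs a construction: if the norm of \<open>h\<close> exceeds \<open>\<tau>\<close>, some \<open>g\<close> in the
  unit ball of the dual space has \<open>\<integral> h g \<ge> \<tau>\<close>. Truncate \<open>h / \<tau>\<close> to a function \<open>k\<close> for which
  \<open>m = \<integral> k powr s\<close> is finite but still larger than \<open>1\<close>, and take \<open>g = k powr (s - 1) / m\<close>. There is no
  need to hit \<open>m = 1\<close>: because \<open>m \<ge> 1\<close> and conjugate exponents are at least \<open>1\<close>, dividing by \<open>m\<close>
  lowers the conjugate modular of \<open>k powr (s - 1)\<close> from \<open>m\<close> to at most \<open>1\<close>, while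
  \<open>\<tau> * \<integral> k powr s / m = \<tau>\<close>.
\<close>

lemma dual_witness:
  assumes s: "proper_exponent n s" and h: "h \<in> borel_measurable (leb n)" and n: "n \<ge> 1"
    and \<tau>: "0 < \<tau>" and large: "1 < modular n s (\<lambda>x. h x / ennreal \<tau>)"
  obtains g :: "(nat \<Rightarrow> real) \<Rightarrow> real" where "g \<in> borel_measurable (leb n)" "\<And>x. 0 \<le> g x"
    "modular n (conj_exp s) (\<lambda>x. ennreal (g x)) \<le> 1"
    "ennreal \<tau> \<le> (\<integral>\<^sup>+x. h x * ennreal (g x) \<partial>leb n)"
proof -
  note [measurable] = proper_exponent_measurable[OF s] h
  define S where "S x = enn2real (s x)" for x
  have [measurable]: "S \<in> borel_measurable (leb n)"
    unfolding S_def by measurable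
  have S: "AE x in leb n. 1 < S x \<and> s x = ennreal (S x)"
    using proper_exponent_AE[OF s] by (auto simp: S_def elim!: eventually_mono)
  define o' :: "nat \<Rightarrow> real" where "o' = (\<lambda>i\<in>{..<n}. 0)"
  have o': "o' \<in> space (leb n)" by (auto simp: o'_def space_leb)
  \<comment> \<open>Truncation of the domain, the exponent and the values makes the integral finite.\<close>
  define A where "A N = eucl_ball n o' (real N + 1) \<inter> {x \<in> space (leb n). S x \<le> real N}" for N
  have [measurable]: "A N \<in> sets (leb n)" for N
    unfolding A_def by measurable
  have A_mono: "A N \<subseteq> A M" if "N \<le> M" for N M
    using that by (auto simp: A_def eucl_ball_eq)
  define k where "k N x = enn2real (min (h x) (of_nat N)) / \<tau> * indicator (A N) x" for N x
  have [measurable]: "k N \<in> borel_measurable (leb n)" for N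
    unfolding k_def by measurable
  have k0: "0 \<le> k N x" for N x
    using \<tau> by (simp add: k_def)
  have k_le: "k N x \<le> N / \<tau>" for N x
  proof -
    have "enn2real (min (h x) (of_nat N)) \<le> N"
      by (intro enn2real_leI) (simp_all flip: ennreal_of_nat_eq_real_of_nat)
    then show ?thesis
      using \<tau> by (auto simp: k_def indicator_def divide_right_mono)
  qed
  have k_h: "ennreal (\<tau> * k N x) \<le> h x" for N x
  proof -
    have "\<tau> * k N x \<le> enn2real (min (h x) (of_nat N))"
      using \<tau> by (auto simp: k_def indicator_def)
    then have "ennreal (\<tau> * k N x) \<le> ennreal (enn2real (min (h x) (of_nat N)))"
      by (rule ennreal_leI)
    also have "\<dots> = min (h x) (of_nat N)"
      by (intro ennreal_enn2real) (auto simp: min_less_iff_disj of_nat_less_top)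
    also have "\<dots> \<le> h x" by simp
    finally show ?thesis .
  qed
  have k_mono: "k N x \<le> k M x" if "N \<le> M" for N M x
  proof -
    have "min (h x) (of_nat N) \<le> min (h x) (of_nat M)"
      using that by (intro min.mono) auto
    then have "enn2real (min (h x) (of_nat N)) \<le> enn2real (min (h x) (of_nat M))"
      by (intro enn2real_mono) (auto simp: min_less_iff_disj of_nat_less_top)
    then show ?thesis
      using A_mono[OF that] \<tau> unfolding k_def
      by (intro mult_mono divide_right_mono) (auto simp: indicator_def)
  qed
  define I where "I N = (\<integral>\<^sup>+x. ennreal (k N x powr S x) \<partial>leb n)" for N
  have lim: "ennpowr (h x / ennreal \<tau>) (S x) \<le> (SUP N. ennreal (k N x powr S x))"
    if x: "x \<in> space (leb n)" and Sx: "1 < S x" for x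
  proof -
    obtain N0 :: nat where N0: "max (edist n x o') (S x) \<le> real N0"
      using real_arch_simple by blast
    have xA: "x \<in> A N" if "N0 \<le> N" for N
    proof -
      have "edist n x o' < real N + 1" "S x \<le> real N"
        using N0 that by auto
      then show ?thesis
        using x by (auto simp: A_def eucl_ball_eq)
    qed
    show ?thesis
    proof (cases "h x")
      case (real r)
      obtain N1 :: nat where N1: "r \<le> real N1"
        using real_arch_simple by blast
      let ?N = "max N0 N1"
      have "min (h x) (of_nat ?N) = ennreal r"
        using ennreal_leI[of r "real ?N"] N1 real
        by (simp add: min_absorb1 flip: ennreal_of_nat_eq_real_of_nat)
      then have "k ?N x = r / \<tau>"
        using real xA[of ?N] by (simp add: k_def)
      moreover have "ennpowr (h x / ennreal \<tau>) (S x) = ennreal ((r / \<tau>) powr S x)"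
        using real \<tau> by (simp add: divide_ennreal)
      ultimately show ?thesis
        by (intro SUP_upper2[of ?N]) auto
    next
      case top
      have "(SUP N. ennreal (k N x powr S x)) = top"
      proof (rule ennreal_SUP_eq_top)
        fix m :: nat
        obtain N1 :: nat where N1: "\<tau> * (real m + 1) \<le> real N1"
          using real_arch_simple by blast
        let ?N = "max N0 N1"
        have "k ?N x = ?N / \<tau>"
          using top xA[of ?N] by (simp add: k_def)
        moreover have "\<tau> * (real m + 1) \<le> real ?N"
          using N1 by simp
        ultimately have km: "real m + 1 \<le> k ?N x"
          using \<tau> by (simp add: pos_le_divide_eq mult.commute)
        then have "k ?N x powr 1 \<le> k ?N x powr S x"
          using Sx by (intro powr_mono) auto
        then have "real m \<le> k ?N x powr S x"
          using km by simp
        then show "\<exists>N\<in>UNIV. of_nat m \<le> ennreal (k N x powr S x)"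
          by (intro bexI[of _ ?N]) (auto simp flip: ennreal_of_nat_eq_real_of_nat intro: ennreal_leI)
      qed
      then show ?thesis by (simp only: top_greatest)
    qed
  qed
  have "modular n s (\<lambda>x. h x / ennreal \<tau>) \<le> (\<integral>\<^sup>+x. (SUP N. ennreal (k N x powr S x)) \<partial>leb n)"
    using S lim s by (auto simp: modular_proper S_def[symmetric] intro!: nn_integral_mono_AE)
  also have "\<dots> = (SUP N. I N)"
    unfolding I_def using S
    by (intro nn_integral_monotone_convergence_SUP_AE)
       (auto intro!: ennreal_leI powr_mono2 k0 k_mono elim!: eventually_mono)
  finally have "1 < (SUP N. I N)"
    using large by (rule less_le_trans[rotated])
  then obtain N where N: "1 < I N"
    by (auto simp: less_SUP_iff)
  have "I N \<le> (\<integral>\<^sup>+x. ennreal ((max 1 (N / \<tau>)) powr real N) * indicator (eucl_ball n o' (real N + 1)) x \<partial>leb n)"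
    unfolding I_def
  proof (rule nn_integral_mono_AE)
    have "ennreal (k N x powr S x)
        \<le> ennreal ((max 1 (N / \<tau>)) powr real N) * indicator (eucl_ball n o' (real N + 1)) x"
      if "1 < S x" for x
    proof (cases "x \<in> A N")
      case True
      have "k N x powr S x \<le> max 1 (N / \<tau>) powr S x"
        using that k0 k_le[of N x] by (intro powr_mono2) auto
      also have "\<dots> \<le> max 1 (N / \<tau>) powr real N"
        using True by (intro powr_mono) (auto simp: A_def)
      finally show ?thesis
        using True by (auto simp: A_def intro: ennreal_leI)
    qed (simp add: k_def)
    then show "AE x in leb n. ennreal (k N x powr S x)
        \<le> ennreal ((max 1 (N / \<tau>)) powr real N) * indicator (eucl_ball n o' (real N + 1)) x"
      using S by (auto elim!: eventually_mono)
  qed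
  also have "\<dots> = ennreal ((max 1 (N / \<tau>)) powr real N) * emeasure (leb n) (eucl_ball n o' (real N + 1))"
    by (simp add: nn_integral_cmult)
  also have "\<dots> < \<infinity>"
    using emeasure_ball_finite(1)[OF n ballsI[OF o', of "real N + 1"]]
    by (simp add: ennreal_mult_less_top)
  finally obtain m where m: "I N = ennreal m" "1 < m"
    using N by (cases "I N") auto
  define g where "g x = k N x powr (S x - 1) / m" for x
  have [measurable]: "g \<in> borel_measurable (leb n)"
    unfolding g_def by measurable
  show ?thesis
  proof
    show "g \<in> borel_measurable (leb n)" by measurable
    show "0 \<le> g x" for x using m by (simp add: g_def)
    have "modular n (conj_exp s) (\<lambda>x. ennreal (g x))
        = modular n (conj_exp s) (\<lambda>x. ennreal (1 / m) * ennreal (k N x powr (S x - 1)))"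
      using m by (simp add: g_def flip: ennreal_mult)
    also have "\<dots> \<le> ennreal (1 / m) * modular n (conj_exp s) (\<lambda>x. ennreal (k N x powr (S x - 1)))"
      using m by (intro modular_contract proper_exponent_conj s) auto
    also have "modular n (conj_exp s) (\<lambda>x. ennreal (k N x powr (S x - 1)))
        = (\<integral>\<^sup>+x. ennpowr (ennreal (k N x powr (S x - 1))) (enn2real (conj_exp s x)) \<partial>leb n)"
      by (intro modular_proper proper_exponent_conj s) measurable
    also have "\<dots> = I N"
      unfolding I_def
    proof (rule nn_integral_cong_AE, rule eventually_mono[OF S])
      fix x assume x: "1 < S x \<and> s x = ennreal (S x)"
      then have "enn2real (conj_exp s x) = S x / (S x - 1)"
        by (simp add: conj_exp_ennreal)
      with x show "ennpowr (ennreal (k N x powr (S x - 1))) (enn2real (conj_exp s x))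
          = ennreal (k N x powr S x)"
        by (simp add: powr_powr)
    qed
    also have "ennreal (1 / m) * I N = 1"
      using m by (simp flip: ennreal_mult)
    finally show "modular n (conj_exp s) (\<lambda>x. ennreal (g x)) \<le> 1" .
    have "ennreal \<tau> = ennreal (\<tau> / m) * I N"
      using m \<tau> by (simp flip: ennreal_mult)
    also have "\<dots> = (\<integral>\<^sup>+x. ennreal (\<tau> / m) * ennreal (k N x powr S x) \<partial>leb n)"
      unfolding I_def by (simp add: nn_integral_cmult)
    also have "\<dots> \<le> (\<integral>\<^sup>+x. h x * ennreal (g x) \<partial>leb n)"
    proof (rule nn_integral_mono_AE)
      have "ennreal (\<tau> / m) * ennreal (k N x powr S x) \<le> h x * ennreal (g x)" for x
      proof -
        have "\<tau> / m * k N x powr S x = \<tau> * k N x * g x"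
          using powr_mult_base[OF k0, of N x "S x - 1"] by (simp add: g_def)
        then have "ennreal (\<tau> / m) * ennreal (k N x powr S x) = ennreal (\<tau> * k N x) * ennreal (g x)"
          using \<tau> m k0 by (simp add: g_def flip: ennreal_mult)
        also have "\<dots> \<le> h x * ennreal (g x)"
          by (intro mult_right_mono k_h) auto
        finally show ?thesis .
      qed
      then show "AE x in leb n. ennreal (\<tau> / m) * ennreal (k N x powr S x) \<le> h x * ennreal (g x)"
        by simp
    qed
    finally show "ennreal \<tau> \<le> (\<integral>\<^sup>+x. h x * ennreal (g x) \<partial>leb n)" .
  qed
qed

text \<open>
  Stated with an upper bound \<open>t > 0\<close> in place of the norm of \<open>f\<close>, so that no product \<open>\<infinity> * 0\<close>
  arises.
\<close>

lemma op_normD: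
  assumes "f \<in> borel_measurable (leb n)" "lp_norm n p (\<lambda>x. ennreal \<bar>f x\<bar>) \<le> ennreal t" "0 < t"
  shows "lp_norm n q (T f) \<le> op_norm n p q T * ennreal t"
proof -
  have "lp_norm n q (T f) / ennreal t \<le> op_norm n p q T"
    unfolding op_norm_def
  proof (rule Inf_greatest, clarify)
    fix C assume "\<forall>f\<in>lp_space n p. lp_norm n q (T f) \<le> C * lp_norm n p (\<lambda>x. ennreal \<bar>f x\<bar>)"
    moreover have "f \<in> lp_space n p"
      using assms by (auto simp: lp_space_def intro: le_less_trans)
    ultimately have "lp_norm n q (T f) \<le> C * ennreal t"
      using assms(2) by (meson order_trans mult_left_mono zero_le)
    then show "lp_norm n q (T f) / ennreal t \<le> C"
      using assms(3) by (intro divide_le_posI_ennreal) (auto simp: mult.commute)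
  qed
  then have "ennreal t * (lp_norm n q (T f) / ennreal t) \<le> ennreal t * op_norm n p q T"
    by (rule mult_left_mono) simp
  then show ?thesis
    using assms(3) ennreal_mult_divide_eq[of "ennreal t" "lp_norm n q (T f)"]
    by (simp add: ennreal_times_divide mult.commute)
qed

section \<open>Sparse selection of balls\<close>

text \<open>
  Pick an element of maximal rank, discard everything it absorbs, and repeat. With \<open>R\<close> meaning
  that two balls meet, and the radius as rank, this is the Vitali covering lemma; the sparse
  family below comes from the same selection with a finer \<open>R\<close>. The disjunction in the conclusion is needed
  since \<open>R\<close> need not be symmetric and ranks may tie.
\<close>

lemma greedy_selection:
  fixes rk :: "'a \<Rightarrow> real"
  assumes "finite X" "\<forall>x\<in>X. R x x"
  shows "\<exists>Y\<subseteq>X. (\<forall>x\<in>X. \<exists>y\<in>Y. rk x \<le> rk y \<and> R x y) \<and>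
    (\<forall>x\<in>Y. \<forall>y\<in>Y. x \<noteq> y \<longrightarrow> (rk x \<le> rk y \<and> \<not> R x y) \<or> (rk y \<le> rk x \<and> \<not> R y x))"
  using assms
proof (induction "card X" arbitrary: X rule: less_induct)
  case less
  show ?case
  proof (cases "X = {}")
    case False
    have "Max (rk ` X) \<in> rk ` X"
      using less.prems(1) False by (intro Max_in) auto
    then obtain m where m: "m \<in> X" "rk m = Max (rk ` X)"
      by auto
    then have max: "rk x \<le> rk m" if "x \<in> X" for x
      using less.prems(1) that by simp
    define X' where "X' = {x \<in> X. \<not> R x m}"
    have "X' \<subset> X"
      using m less.prems(2) by (auto simp: X'_def)
    then have "card X' < card X"
      using less.prems(1) by (rule psubset_card_mono[rotated])
    moreover have "finite X'" "\<forall>x\<in>X'. R x x"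
      using less.prems by (auto simp: X'_def)
    ultimately have "\<exists>Y\<subseteq>X'. (\<forall>x\<in>X'. \<exists>y\<in>Y. rk x \<le> rk y \<and> R x y) \<and>
        (\<forall>x\<in>Y. \<forall>y\<in>Y. x \<noteq> y \<longrightarrow> (rk x \<le> rk y \<and> \<not> R x y) \<or> (rk y \<le> rk x \<and> \<not> R y x))"
      by (rule less.hyps)
    then obtain Y where Y: "Y \<subseteq> X'" "\<forall>x\<in>X'. \<exists>y\<in>Y. rk x \<le> rk y \<and> R x y"
      "\<forall>x\<in>Y. \<forall>y\<in>Y. x \<noteq> y \<longrightarrow> (rk x \<le> rk y \<and> \<not> R x y) \<or> (rk y \<le> rk x \<and> \<not> R y x)"
      by (elim exE conjE)
    have m_Y: "rk y \<le> rk m \<and> \<not> R y m" if "y \<in> Y" for y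
      using that Y(1) max by (auto simp: X'_def)
    show ?thesis
    proof (intro exI[of _ "insert m Y"] conjI ballI impI)
      show "insert m Y \<subseteq> X"
        using Y(1) m by (auto simp: X'_def)
      show "\<exists>y\<in>insert m Y. rk x \<le> rk y \<and> R x y" if "x \<in> X" for x
      proof (cases "R x m")
        case True
        with max[OF that] show ?thesis by simp
      next
        case False
        then have "x \<in> X'" using that by (simp add: X'_def)
        with Y(2) show ?thesis by blast
      qed
      show "(rk x \<le> rk y \<and> \<not> R x y) \<or> (rk y \<le> rk x \<and> \<not> R y x)"
        if xy: "x \<in> insert m Y" "y \<in> insert m Y" "x \<noteq> y" for x y
      proof -
        consider "x = m" "y \<in> Y" | "y = m" "x \<in> Y" | "x \<in> Y" "y \<in> Y"
          using xy by auto
        then show ?thesis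
        proof cases
          case 1 then show ?thesis using m_Y[of y] by simp
        next
          case 2 then show ?thesis using m_Y[of x] by simp
        next
          case 3 then show ?thesis using Y(3) xy(3) by simp
        qed
      qed
    qed
  qed auto
qed

text \<open>
  Selections run over pairs of a centre and a radius, so that the radius and the dilated ball
  are functions of the index.
\<close>

abbreviation pball :: "nat \<Rightarrow> (nat \<Rightarrow> real) \<times> real \<Rightarrow> (nat \<Rightarrow> real) set" where
  "pball n S \<equiv> eucl_ball n (fst S) (snd S)"

abbreviation pball4 :: "nat \<Rightarrow> (nat \<Rightarrow> real) \<times> real \<Rightarrow> (nat \<Rightarrow> real) set" where
  "pball4 n S \<equiv> eucl_ball n (fst S) (4 * snd S)"

lemma pball_engulf:
  assumes "pball n S \<inter> pball n S' \<noteq> {}" "snd S \<le> snd S'"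
  shows "pball n S \<subseteq> pball4 n S'"
proof -
  obtain x where x: "x \<in> pball n S" "x \<in> pball n S'"
    using assms(1) by auto
  then have "edist n (fst S) (fst S') < snd S + snd S'"
    using edist_triangle[of n "fst S" "fst S'" x] edist_commute[of n "fst S" x]
    by (simp add: eucl_ball_eq)
  moreover have "0 \<le> edist n x (fst S)"
    by (simp add: edist_def)
  then have "0 < snd S"
    using x(1) by (simp add: eucl_ball_eq)
  ultimately show ?thesis
    using assms(2) by (intro eucl_ball_subset) linarith
qed

lemma Vitali_selection:
  assumes "finite X" "\<And>S. S \<in> X \<Longrightarrow> fst S \<in> space (leb n) \<and> 0 < snd S"
  obtains Y where "Y \<subseteq> X" "disjoint_family_on (pball n) Y" "(\<Union>S\<in>X. pball n S) \<subseteq> (\<Union>S\<in>Y. pball4 n S)"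
proof -
  let ?R = "\<lambda>S S'. pball n S \<inter> pball n S' \<noteq> {}"
  have refl: "\<forall>S\<in>X. ?R S S"
    using assms(2) by (force simp: eucl_ball_eq)
  obtain Y where Y: "Y \<subseteq> X" "\<forall>S\<in>X. \<exists>S'\<in>Y. snd S \<le> snd S' \<and> ?R S S'"
    "\<forall>x\<in>Y. \<forall>y\<in>Y. x \<noteq> y \<longrightarrow> (snd x \<le> snd y \<and> \<not> ?R x y) \<or> (snd y \<le> snd x \<and> \<not> ?R y x)"
    using greedy_selection[of X ?R snd, OF assms(1) refl] by (elim exE conjE) (rule that)
  show ?thesis
  proof
    show "Y \<subseteq> X" by fact
    show "disjoint_family_on (pball n) Y"
      unfolding disjoint_family_on_def using Y(3) by blast
    show "(\<Union>S\<in>X. pball n S) \<subseteq> (\<Union>S\<in>Y. pball4 n S)"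
    proof
      fix x assume "x \<in> (\<Union>S\<in>X. pball n S)"
      then obtain S where S: "S \<in> X" "x \<in> pball n S" by auto
      with Y(2) obtain S' where "S' \<in> Y" "snd S \<le> snd S'" "?R S S'" by meson
      then show "x \<in> (\<Union>S\<in>Y. pball4 n S)"
        using pball_engulf[of n S S'] S(2) by auto
    qed
  qed
qed

lemma avg_nonneg: "0 \<le> avg n \<phi> B"
  by (simp add: avg_def)

lemma avg_le_superball:
  assumes "n \<ge> 1" "B \<in> balls n" "B' \<in> balls n" "\<phi> \<in> borel_measurable (leb n)"
    and "(\<integral>\<^sup>+x\<in>B'. \<phi> x \<partial>leb n) < \<infinity>" "B \<subseteq> B'" "measure (leb n) B' \<le> k * measure (leb n) B"
  shows "avg n \<phi> B \<le> k * avg n \<phi> B'"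
proof -
  have le: "(\<integral>\<^sup>+x\<in>B. \<phi> x \<partial>leb n) \<le> (\<integral>\<^sup>+x\<in>B'. \<phi> x \<partial>leb n)"
    using assms(6) by (intro nn_integral_mono) (auto simp: indicator_def)
  then have "(\<integral>\<^sup>+x\<in>B. \<phi> x \<partial>leb n) < \<infinity>"
    using assms(5) by (rule le_less_trans)
  then have "avg n \<phi> B * measure (leb n) B \<le> avg n \<phi> B' * measure (leb n) B'"
    using le assms by (simp add: integral_avg avg_nonneg ennreal_le_iff)
  also have "\<dots> \<le> avg n \<phi> B' * (k * measure (leb n) B)"
    using assms(7) by (intro mult_left_mono avg_nonneg)
  finally have "avg n \<phi> B * measure (leb n) B \<le> (k * avg n \<phi> B') * measure (leb n) B"
    by (simp add: algebra_simps)
  then show ?thesis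
    using measure_ball_pos[OF assms(1,2)] by simp
qed

text \<open>
  The mean of an integrable function over the ball of radius \<open>2 ^ j * r\<close> tends to \<open>0\<close>, so it is largest
  for some \<open>j\<close>. Stopping there makes the mean over the ball of radius \<open>R\<close> control the mean over its
  fourfold dilate.
\<close>

lemma exists_maximal_dilate:
  assumes n: "n \<ge> 1" and \<phi>: "\<phi> \<in> borel_measurable (leb n)" "(\<integral>\<^sup>+x. \<phi> x \<partial>leb n) < \<infinity>"
    and c: "c \<in> space (leb n)" "0 < r" and pos: "0 < avg n \<phi> (eucl_ball n c r)"
  obtains R where "r \<le> R" "avg n \<phi> (eucl_ball n c r) \<le> avg n \<phi> (eucl_ball n c R)"
    "avg n \<phi> (eucl_ball n c (4 * R)) \<le> avg n \<phi> (eucl_ball n c R)"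
proof -
  define w where "w j = avg n \<phi> (eucl_ball n c (2 ^ j * r))" for j :: nat
  have w0: "0 < w 0" using pos by (simp add: w_def)
  define M where "M = enn2real (\<integral>\<^sup>+x. \<phi> x \<partial>leb n)"
  define y where "y = 2 * (r / sqrt n)"
  have y: "0 < y" using n c by (simp add: y_def)
  obtain J where J: "max 1 (M / w 0) / y < 2 ^ J"
    using real_arch_pow[of 2 "max 1 (M / w 0) / y"] by auto
  have small: "w j < w 0" if "J \<le> j" for j
  proof -
    have B: "eucl_ball n c (2 ^ j * r) \<in> balls n"
      using c by (intro ballsI) auto
    let ?W = "measure (leb n) (eucl_ball n c (2 ^ j * r))"
    have "(2 :: real) ^ J \<le> 2 ^ j" using that by simp
    with J have "max 1 (M / w 0) / y < 2 ^ j" by linarith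
    then have big: "max 1 (M / w 0) < 2 ^ j * y"
      using y by (simp add: field_simps)
    then have "2 ^ j * y \<le> (2 ^ j * y) ^ n"
      using n self_le_power[of "2 ^ j * y" n] by simp
    also have "\<dots> = (2 * (2 ^ j * r / sqrt n)) ^ n"
      by (simp add: y_def algebra_simps)
    also have "\<dots> \<le> ?W"
      using n c by (intro measure_eucl_ball_bounds) auto
    finally have MW: "M / w 0 < ?W"
      using big by linarith
    have le: "(\<integral>\<^sup>+x\<in>eucl_ball n c (2 ^ j * r). \<phi> x \<partial>leb n) \<le> (\<integral>\<^sup>+x. \<phi> x \<partial>leb n)"
      by (intro nn_integral_mono) (auto simp: indicator_def)
    also have "\<dots> = ennreal M"
      using \<phi>(2) by (simp add: M_def)
    finally have "w j * ?W \<le> M"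
      using integral_avg[OF n B \<phi>(1)] le_less_trans[OF le \<phi>(2)]
      by (simp add: w_def ennreal_le_iff M_def)
    also have "M < w 0 * ?W"
      using MW w0 by (simp add: field_simps)
    finally show ?thesis
      using measure_ball_pos[OF n B] by simp
  qed
  have "Max (w ` {..J}) \<in> w ` {..J}"
    by (intro Max_in) auto
  then obtain m where m: "w m = Max (w ` {..J})" by (metis imageE)
  have max: "w j \<le> w m" for j
  proof (cases "j \<le> J")
    case False
    then have "w j < w 0" using small by simp
    also have "w 0 \<le> w m" unfolding m by simp
    finally show ?thesis by simp
  qed (simp add: m)
  show ?thesis
  proof
    show "r \<le> 2 ^ m * r" using c by simp
    show "avg n \<phi> (eucl_ball n c r) \<le> avg n \<phi> (eucl_ball n c (2 ^ m * r))"
      using max[of 0] by (simp add: w_def)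
    show "avg n \<phi> (eucl_ball n c (4 * (2 ^ m * r))) \<le> avg n \<phi> (eucl_ball n c (2 ^ m * r))"
      using max[of "m + 2"] by (simp add: w_def algebra_simps)
  qed
qed

text \<open>
  A finite family of balls is dominated by a sparse one. Replace every ball by a dilate as in the
  preceding lemma, and select greedily by decreasing radius, where \<open>S\<close> absorbs the smaller balls that
  meet it and whose mean is at most \<open>\<Lambda>\<close> times its own. An absorbed ball lies in the fourfold dilate
  of the absorbing one, which gives the domination.

  Two selected balls that meet have means differing by a factor more than \<open>\<Lambda>\<close>, the smaller ball having
  the larger mean. Thus the selected balls that are smaller than \<open>S\<close> and meet it all lie where the maximal
  function exceeds \<open>\<Lambda>\<close> times the mean over \<open>S\<close>; by the Vitali covering lemma inside the dilate of \<open>S\<close>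
  (whose mean is not larger) they cover at most half of \<open>S\<close> once \<open>\<Lambda> = 2 * D ^ 4\<close>. The set \<open>E S\<close>
  is what they leave of \<open>S\<close>.
\<close>

lemma sparse_selection:
  assumes n: "n \<ge> 1" and \<phi>: "\<phi> \<in> borel_measurable (leb n)" "(\<integral>\<^sup>+x. \<phi> x \<partial>leb n) < \<infinity>"
    and \<F>: "finite \<F>" "\<F> \<subseteq> balls n"
  obtains I :: "((nat \<Rightarrow> real) \<times> real) set" and Q E where "finite I"
    "\<And>i. i \<in> I \<Longrightarrow> Q i \<in> balls n" "\<And>i. i \<in> I \<Longrightarrow> E i \<in> sets (leb n)" "\<And>i. i \<in> I \<Longrightarrow> E i \<subseteq> Q i"
    "\<And>i. i \<in> I \<Longrightarrow> measure (leb n) (Q i) \<le> 2 * (doubling n)\<^sup>2 * measure (leb n) (E i)"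
    "disjoint_family_on E I"
    "\<And>B. B \<in> \<F> \<Longrightarrow> 0 < avg n \<phi> B \<Longrightarrow> \<exists>i\<in>I. B \<subseteq> Q i \<and> avg n \<phi> B \<le> 2 * doubling n ^ 6 * avg n \<phi> (Q i)"
proof -
  note [measurable] = \<phi>(1)
  define D where "D = doubling n"
  have D: "1 \<le> D" using n by (simp add: D_def doubling_ge_1)
  define v where "v S = avg n \<phi> (pball n S)" for S
  have v0: "0 \<le> v S" for S by (simp add: v_def avg_nonneg)
  have int_fin: "(\<integral>\<^sup>+x\<in>B. \<phi> x \<partial>leb n) < \<infinity>" for B
  proof -
    have "(\<integral>\<^sup>+x\<in>B. \<phi> x \<partial>leb n) \<le> (\<integral>\<^sup>+x. \<phi> x \<partial>leb n)"
      by (intro nn_integral_mono) (auto simp: indicator_def)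
    then show ?thesis using \<phi>(2) by (rule le_less_trans)
  qed
  define good where "good S \<longleftrightarrow> fst S \<in> space (leb n) \<and> 0 < snd S \<and> 0 < v S
    \<and> avg n \<phi> (pball4 n S) \<le> v S" for S
  have "\<exists>S. good S \<and> B \<subseteq> pball n S \<and> avg n \<phi> B \<le> v S" if B: "B \<in> \<F>" "0 < avg n \<phi> B" for B
  proof -
    obtain c r where cr: "B = eucl_ball n c r" "c \<in> space (leb n)" "0 < r"
      using B \<F> by (meson ballsE subsetD)
    obtain R where R: "r \<le> R" "avg n \<phi> (eucl_ball n c r) \<le> avg n \<phi> (eucl_ball n c R)"
      "avg n \<phi> (eucl_ball n c (4 * R)) \<le> avg n \<phi> (eucl_ball n c R)"
      using exists_maximal_dilate[OF n \<phi> cr(2,3)] B(2) cr(1) by metis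
    have "B \<subseteq> eucl_ball n c R"
      unfolding cr(1) using R(1) by (intro eucl_ball_subset) simp
    then show ?thesis
      using R cr B(2) by (intro exI[of _ "(c, R)"]) (auto simp: good_def v_def)
  qed
  then obtain hat where hat: "good (hat B)" "B \<subseteq> pball n (hat B)" "avg n \<phi> B \<le> v (hat B)"
    if "B \<in> \<F>" "0 < avg n \<phi> B" for B
    by metis
  define \<G> where "\<G> = hat ` {B \<in> \<F>. 0 < avg n \<phi> B}"
  have \<G>: "finite \<G>" "\<And>S. S \<in> \<G> \<Longrightarrow> good S"
    using \<F>(1) hat by (auto simp: \<G>_def)
  \<comment> \<open>Two factors \<open>D\<close> for the mass in the dilate of \<open>S\<close>, two for the dilates in the covering lemma.\<close>
  define \<Lambda> where "\<Lambda> = 2 * D ^ 4"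
  have \<Lambda>: "1 \<le> \<Lambda>" using one_le_power[OF D, of 4] by (simp add: \<Lambda>_def)
  let ?R = "\<lambda>S S'. pball n S \<inter> pball n S' \<noteq> {} \<and> v S \<le> \<Lambda> * v S'"
  have refl: "\<forall>S\<in>\<G>. ?R S S"
  proof
    fix S assume "S \<in> \<G>"
    have "1 * v S \<le> \<Lambda> * v S" using \<Lambda> v0 by (intro mult_right_mono)
    then show "?R S S"
      using \<G>(2)[OF \<open>S \<in> \<G>\<close>] by (auto simp: good_def eucl_ball_eq)
  qed
  obtain I where I: "I \<subseteq> \<G>" "\<forall>S\<in>\<G>. \<exists>S'\<in>I. snd S \<le> snd S' \<and> ?R S S'"
    "\<forall>x\<in>I. \<forall>y\<in>I. x \<noteq> y \<longrightarrow> (snd x \<le> snd y \<and> \<not> ?R x y) \<or> (snd y \<le> snd x \<and> \<not> ?R y x)"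
    using greedy_selection[of \<G> ?R snd, OF \<G>(1) refl] by (elim exE conjE) (rule that)
  have finI: "finite I" using I(1) \<G>(1) by (rule finite_subset)
  have good: "good S" if "S \<in> I" for S using \<G>(2) I(1) that by (meson subsetD)
  have balls: "pball n S \<in> balls n" "pball4 n S \<in> balls n" if "S \<in> I" for S
    using good[OF that] by (auto simp: good_def intro!: ballsI)
  have meas4: "measure (leb n) (pball4 n S) \<le> D\<^sup>2 * measure (leb n) (pball n S)" if "S \<in> I" for S
    using good[OF that] measure_eucl_ball_quadruple[OF n] by (auto simp: good_def D_def)
  define X where "X S = {S' \<in> I. snd S' \<le> snd S \<and> pball n S' \<inter> pball n S \<noteq> {} \<and> \<Lambda> * v S < v S'}" for S
  define E where "E S = pball n S - (\<Union>S'\<in>X S. pball n S')" for S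
  have X_fin: "finite (X S)" for S using finI by (simp add: X_def)
  have E_sets: "E S \<in> sets (leb n)" for S
    unfolding E_def using X_fin by (intro sets.Diff sets.finite_UN) auto
  have X_small: "measure (leb n) (\<Union>S'\<in>X S. pball n S') \<le> measure (leb n) (pball n S) / 2" if S: "S \<in> I" for S
  proof -
    have XI: "X S \<subseteq> I" by (auto simp: X_def)
    have "fst S' \<in> space (leb n) \<and> 0 < snd S'" if "S' \<in> X S" for S'
      using good[of S'] that XI by (auto simp: good_def)
    with X_fin obtain Y where Y: "Y \<subseteq> X S" "disjoint_family_on (pball n) Y"
      "(\<Union>S'\<in>X S. pball n S') \<subseteq> (\<Union>S'\<in>Y. pball4 n S')"
      using Vitali_selection[of "X S" n] by blast
    have finY: "finite Y" using Y(1) X_fin by (rule finite_subset)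
    have YI: "S' \<in> I" if "S' \<in> Y" for S' using that Y(1) XI by auto
    have vS: "0 < v S" using good[OF S] by (simp add: good_def)
    let ?W = "\<lambda>S. measure (leb n) (pball n S)"
    have "(\<Sum>S'\<in>Y. ennreal (v S' * ?W S')) = (\<Sum>S'\<in>Y. \<integral>\<^sup>+x\<in>pball n S'. \<phi> x \<partial>leb n)"
      using integral_avg[OF n balls(1) \<phi>(1) int_fin] YI by (intro sum.cong) (auto simp: v_def)
    also have "\<dots> = (\<integral>\<^sup>+x. (\<Sum>S'\<in>Y. \<phi> x * indicator (pball n S') x) \<partial>leb n)"
      by (intro nn_integral_sum[symmetric]) measurable
    also have "\<dots> \<le> (\<integral>\<^sup>+x\<in>pball4 n S. \<phi> x \<partial>leb n)"
    proof (rule nn_integral_mono)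
      fix x
      have "(\<Sum>S'\<in>Y. \<phi> x * indicator (pball n S') x) = \<phi> x * indicator (\<Union>S'\<in>Y. pball n S') x"
        using finY Y(2) by (simp add: indicator_UN_disjoint sum_distrib_left)
      also have "\<dots> \<le> \<phi> x * indicator (pball4 n S) x"
      proof -
        have "(\<Union>S'\<in>Y. pball n S') \<subseteq> pball4 n S"
          using Y(1) pball_engulf[of n _ S] by (auto simp: X_def)
        then show ?thesis
          by (intro mult_left_mono) (auto simp: indicator_def)
      qed
      finally show "(\<Sum>S'\<in>Y. \<phi> x * indicator (pball n S') x) \<le> \<phi> x * indicator (pball4 n S) x" .
    qed
    also have "\<dots> = ennreal (avg n \<phi> (pball4 n S) * measure (leb n) (pball4 n S))"
      by (rule integral_avg[OF n balls(2)[OF S] \<phi>(1) int_fin])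
    finally have "ennreal (\<Sum>S'\<in>Y. v S' * ?W S')
        \<le> ennreal (avg n \<phi> (pball4 n S) * measure (leb n) (pball4 n S))"
      using v0 by (subst sum_ennreal[symmetric]) auto
    then have "(\<Sum>S'\<in>Y. v S' * ?W S') \<le> avg n \<phi> (pball4 n S) * measure (leb n) (pball4 n S)"
      by (simp add: ennreal_le_iff avg_nonneg)
    also have "\<dots> \<le> v S * (D\<^sup>2 * ?W S)"
      using good[OF S] meas4[OF S] v0 by (intro mult_mono) (auto simp: good_def)
    finally have 1: "(\<Sum>S'\<in>Y. v S' * ?W S') \<le> v S * (D\<^sup>2 * ?W S)" .
    have "\<Lambda> * v S * (\<Sum>S'\<in>Y. ?W S') \<le> (\<Sum>S'\<in>Y. v S' * ?W S')"
      unfolding sum_distrib_left using Y(1)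
      by (intro sum_mono mult_right_mono) (auto simp: X_def intro: less_imp_le)
    with 1 have "\<Lambda> * v S * (\<Sum>S'\<in>Y. ?W S') \<le> v S * (D\<^sup>2 * ?W S)" by linarith
    then have 2: "\<Lambda> * (\<Sum>S'\<in>Y. ?W S') \<le> D\<^sup>2 * ?W S"
      using vS by (simp add: mult.assoc mult.left_commute[of _ "v S"])
    have "measure (leb n) (\<Union>S'\<in>X S. pball n S') \<le> measure (leb n) (\<Union>S'\<in>Y. pball4 n S')"
    proof (rule measure_mono_fmeasurable[OF Y(3)])
      show "(\<Union>S'\<in>X S. pball n S') \<in> sets (leb n)"
        using X_fin by (intro sets.finite_UN) auto
      show "(\<Union>S'\<in>Y. pball4 n S') \<in> fmeasurable (leb n)"
        using finY balls(2)[OF YI] n by (intro fmeasurable.finite_UN) (auto intro!: fmeasurableI)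
    qed
    also have "\<dots> \<le> (\<Sum>S'\<in>Y. measure (leb n) (pball4 n S'))"
      using finY balls(2)[OF YI] n by (intro measure_UNION_le) auto
    also have "\<dots> \<le> (\<Sum>S'\<in>Y. D\<^sup>2 * ?W S')"
      using YI by (intro sum_mono meas4)
    also have "\<dots> = D\<^sup>2 * (\<Sum>S'\<in>Y. ?W S')"
      by (simp add: sum_distrib_left)
    finally have 3: "measure (leb n) (\<Union>S'\<in>X S. pball n S') \<le> D\<^sup>2 * (\<Sum>S'\<in>Y. ?W S')" .
    have "2 * D ^ 4 * (\<Sum>S'\<in>Y. ?W S') = D\<^sup>2 * (2 * (D\<^sup>2 * (\<Sum>S'\<in>Y. ?W S')))"
      by (simp add: power2_eq_square power4_eq_xxxx)
    with 2 have "D\<^sup>2 * (2 * (D\<^sup>2 * (\<Sum>S'\<in>Y. ?W S'))) \<le> D\<^sup>2 * ?W S"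
      by (simp add: \<Lambda>_def)
    then have "2 * (D\<^sup>2 * (\<Sum>S'\<in>Y. ?W S')) \<le> ?W S"
      using D by (subst (asm) mult_le_cancel_left_pos) auto
    with 3 show ?thesis by linarith
  qed
  show ?thesis
  proof (rule that[of I "pball4 n" E])
    show "finite I" by fact
    show "pball4 n S \<in> balls n" if "S \<in> I" for S using balls[OF that] by simp
    show "E S \<in> sets (leb n)" for S by fact
    show "E S \<subseteq> pball4 n S" if "S \<in> I" for S
    proof -
      have "pball n S \<subseteq> pball4 n S"
        using good[OF that] by (intro eucl_ball_subset) (auto simp: good_def)
      then show ?thesis by (auto simp: E_def)
    qed
    show "measure (leb n) (pball4 n S) \<le> 2 * (doubling n)\<^sup>2 * measure (leb n) (E S)" if S: "S \<in> I" for S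
    proof -
      have "E S = pball n S - (pball n S \<inter> (\<Union>S'\<in>X S. pball n S'))"
        by (auto simp: E_def)
      moreover have U: "(\<Union>S'\<in>X S. pball n S') \<in> fmeasurable (leb n)"
        using X_fin balls(1) n
        by (intro fmeasurable.finite_UN) (auto intro!: fmeasurableI simp: X_def)
      ultimately have "measure (leb n) (E S)
          = measure (leb n) (pball n S) - measure (leb n) (pball n S \<inter> (\<Union>S'\<in>X S. pball n S'))"
        using balls(1)[OF S] n by (simp add: measure_Diff fmeasurableD)
      moreover have "measure (leb n) (pball n S \<inter> (\<Union>S'\<in>X S. pball n S'))
          \<le> measure (leb n) (\<Union>S'\<in>X S. pball n S')"
        using U by (intro measure_mono_fmeasurable) (auto dest: fmeasurableD)
      ultimately have "measure (leb n) (pball n S) \<le> 2 * measure (leb n) (E S)"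
        using X_small[OF S] by linarith
      then have "D\<^sup>2 * measure (leb n) (pball n S) \<le> D\<^sup>2 * (2 * measure (leb n) (E S))"
        by (intro mult_left_mono) auto
      with meas4[OF S] show ?thesis by (simp add: D_def)
    qed
    show "disjoint_family_on E I"
      unfolding disjoint_family_on_def
    proof (intro ballI impI)
      have *: "E S \<inter> E S' = {}" if "S \<in> I" "snd S \<le> snd S' \<and> \<not> ?R S S'" for S S'
      proof (cases "pball n S \<inter> pball n S' = {}")
        case False
        then have "S \<in> X S'" using that by (auto simp: X_def)
        then show ?thesis by (auto simp: E_def)
      qed (auto simp: E_def)
      fix S S' assume "S \<in> I" "S' \<in> I" "S \<noteq> S'"
      then show "E S \<inter> E S' = {}"
        using I(3) *[of S S'] *[of S' S] by blast
    qed
    show "\<exists>S\<in>I. B \<subseteq> pball4 n S \<and> avg n \<phi> B \<le> 2 * doubling n ^ 6 * avg n \<phi> (pball4 n S)"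
      if B: "B \<in> \<F>" "0 < avg n \<phi> B" for B
    proof -
      have "hat B \<in> \<G>" using B by (auto simp: \<G>_def)
      then obtain S where S: "S \<in> I" "snd (hat B) \<le> snd S" "?R (hat B) S"
        using I(2) by blast
      have "B \<subseteq> pball4 n S"
        using hat(2)[OF B] pball_engulf[of n "hat B" S] S by auto
      moreover have "v S \<le> D\<^sup>2 * avg n \<phi> (pball4 n S)"
        unfolding v_def using good[OF S(1)] meas4[OF S(1)]
        by (intro avg_le_superball n balls S(1) \<phi> int_fin eucl_ball_subset) (auto simp: good_def)
      moreover have "avg n \<phi> B \<le> \<Lambda> * v S"
        using hat(3)[OF B] S(3) by linarith
      ultimately have "avg n \<phi> B \<le> \<Lambda> * (D\<^sup>2 * avg n \<phi> (pball4 n S))"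
        using \<Lambda> by (smt (verit) mult_left_mono)
      also have "\<dots> = 2 * doubling n ^ 6 * avg n \<phi> (pball4 n S)"
        by (simp add: \<Lambda>_def D_def flip: power_add)
      finally show ?thesis
        using S(1) \<open>B \<subseteq> pball4 n S\<close> by blast
    qed
  qed
qed

section \<open>The estimate on one ball\<close>

lemma Young_powr:
  fixes y g Q :: real
  assumes "0 \<le> y" "0 \<le> g" "1 < Q"
  shows "y * g \<le> y powr Q + g powr (Q / (Q - 1))"
proof (cases "g \<le> y powr (Q - 1)")
  case True
  then have "y * g \<le> y * y powr (Q - 1)"
    using assms by (intro mult_left_mono)
  also have "\<dots> = y powr Q"
    using powr_mult_base[OF assms(1), of "Q - 1"] by simp
  finally show ?thesis by (simp add: add_increasing2)
next
  case False
  then have "(y powr (Q - 1)) powr (1 / (Q - 1)) \<le> g powr (1 / (Q - 1))"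
    using assms by (intro powr_mono2) auto
  then have "y \<le> g powr (1 / (Q - 1))"
    using assms by (simp add: powr_powr)
  then have "y * g \<le> g * g powr (1 / (Q - 1))"
    using assms by (simp add: mult.commute mult_left_mono)
  also have "\<dots> = g powr (Q / (Q - 1))"
    using powr_mult_base[OF assms(2), of "1 / (Q - 1)"] assms by (simp add: field_simps)
  finally show ?thesis by (simp add: add_increasing)
qed

text \<open>
  At a point where the three normalised quantities are bounded, the fractional factor is
  absorbed by the exponents. The bounds on \<open>l\<close> and \<open>m\<close> give \<open>W powr (1 / Q + (P - 1) / P) \<le> T * l * m\<close>,
  hence \<open>W powr a \<le> K * T * W powr (1 / P - 1 / Q)\<close> by the Muckenhoupt bound on \<open>l * m\<close>. The exponent
  \<open>1 / P - 1 / Q\<close> is nonnegative and \<open>W \<le> f powr (- P)\<close>, so \<open>f * W powr (1 / P - 1 / Q) \<le> f powr (P / Q)\<close>, and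
  Young's inequality with exponent \<open>Q\<close> finishes.
\<close>

lemma pointwise_estimate:
  fixes W T P Q a f g l m K :: real
  assumes pos: "0 < W" "0 < l" "0 < m" "0 < K" and T: "1 \<le> T" and PQ: "1 < P" "P \<le> Q"
    and fg: "0 \<le> f" "0 \<le> g"
    and l: "W * (1 / l) powr Q \<le> T" and m: "W * (1 / m) powr (P / (P - 1)) \<le> T"
    and f: "W * f powr P \<le> 1" and K: "l * m \<le> K * W powr (1 - a)"
  shows "W powr a * f * g \<le> K * T * (f powr P + g powr (Q / (Q - 1)))"
proof -
  define e where "e = 1 / Q + (P - 1) / P"
  define d where "d = 1 / P - 1 / Q"
  have ed: "1 - e = d"
    using PQ by (simp add: e_def d_def field_simps)
  have d0: "0 \<le> d"
    using PQ by (simp add: d_def frac_le)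
  have root: "(W / T) powr (1 / s) \<le> r" if "W * (1 / r) powr s \<le> T" "0 < r" "0 < s" for r s
  proof -
    have "W / r powr s \<le> T"
      using that by (simp add: powr_divide)
    moreover have "0 < r powr s"
      using that by simp
    ultimately have "W / T \<le> r powr s"
      using T by (simp add: field_simps)
    then have "(W / T) powr (1 / s) \<le> (r powr s) powr (1 / s)"
      using pos T that by (intro powr_mono2) auto
    then show ?thesis
      using that by (simp add: powr_powr)
  qed
  have "(W / T) powr (1 / Q) \<le> l"
    using root[OF l pos(2)] PQ by simp
  moreover have "(W / T) powr ((P - 1) / P) \<le> m"
    using root[OF m pos(3)] PQ by simp
  ultimately have "(W / T) powr (1 / Q) * (W / T) powr ((P - 1) / P) \<le> l * m"
    using pos by (intro mult_mono) auto
  then have "(W / T) powr e \<le> l * m"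
    by (simp add: e_def powr_add)
  then have "W powr e / T powr e \<le> K * W powr (1 - a)"
    using K pos T by (simp add: powr_divide)
  moreover have "W powr e / T \<le> W powr e / T powr e"
  proof -
    have "T powr e \<le> T powr 1"
      using T ed d0 by (intro powr_mono) auto
    then show ?thesis
      using T by (intro divide_left_mono) auto
  qed
  ultimately have "W powr e / T \<le> K * W powr (1 - a)"
    by linarith
  then have "W powr e \<le> K * T * W powr (1 - a)"
    using T by (simp add: field_simps)
  then have "W powr e * W powr (a - e) \<le> K * T * W powr (1 - a) * W powr (a - e)"
    by (rule mult_right_mono) simp
  then have Wa: "W powr a \<le> K * T * W powr d"
    by (simp add: mult.assoc flip: powr_add ed)
  have fd: "f * W powr d \<le> f powr (P / Q)"
  proof (cases "f = 0")
    case False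
    with fg have f0: "0 < f" by simp
    have "W \<le> f powr (- P)"
      using f f0 by (simp add: powr_minus field_simps)
    then have "W powr d \<le> (f powr (- P)) powr d"
      using pos d0 by (intro powr_mono2) auto
    also have "\<dots> = f powr (P / Q - 1)"
    proof -
      have "- P * d = P / Q - 1"
        using PQ by (simp add: d_def right_diff_distrib)
      then show ?thesis
        by (simp only: powr_powr)
    qed
    finally have "f * W powr d \<le> f * f powr (P / Q - 1)"
      using f0 by (intro mult_left_mono) auto
    then show ?thesis
      using powr_mult_base[of f "P / Q - 1"] f0 by simp
  qed simp
  have "W powr a * f * g \<le> K * T * W powr d * f * g"
    using Wa fg by (intro mult_right_mono)
  also have "\<dots> = K * T * (f * W powr d) * g"
    by (simp add: algebra_simps)
  also have "\<dots> \<le> K * T * f powr (P / Q) * g"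
    using fd pos T fg by (intro mult_right_mono mult_left_mono) auto
  also have "\<dots> \<le> K * T * (f powr P + g powr (Q / (Q - 1)))"
    using Young_powr[of "f powr (P / Q)" g Q] PQ pos T fg
    by (simp add: powr_powr mult.assoc)
  finally show ?thesis .
qed

lemma conj_exp_exponents:
  assumes "p \<in> exponents n"
  shows "conj_exp p \<in> exponents n"
proof -
  have [measurable]: "p \<in> borel_measurable (leb n)"
    using assms by (simp add: exponents_def)
  have "1 \<le> 1 / x" if "x \<le> 1" for x :: ennreal
  proof (cases x)
    case (real r)
    with that show ?thesis
      using divide_ennreal[of 1 r] by (cases "r = 0") (auto simp: field_simps)
  qed (use that in \<open>simp add: top_unique\<close>)
  then have "1 \<le> conj_exp p x" for x
    by (auto simp: conj_exp_def diff_le_self_ennreal)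
  moreover have "conj_exp p \<in> borel_measurable (leb n)"
    unfolding conj_exp_def[abs_def] by measurable
  ultimately show ?thesis
    by (simp add: exponents_def)
qed

lemma lp_norm_indicator_real:
  assumes "n \<ge> 1" "s \<in> exponents n" "proper_exponent n s" "B \<in> balls n"
  obtains r where "0 < r" "lp_norm n s (indicator B) = ennreal r"
proof -
  have "lp_norm n s (indicator B) < \<infinity>"
    using assms by (intro lp_norm_indicator_finite) auto
  moreover have "0 < lp_norm n s (indicator B)"
    using assms by (intro lp_norm_indicator_pos) auto
  ultimately show ?thesis
    using that by (cases "lp_norm n s (indicator B)") auto
qed

text \<open>
  Think of \<open>u\<close>, \<open>v\<close> as the means of two functions over \<open>B\<close> and of \<open>F\<close>, \<open>G\<close> as their maximal functions. The
  pointwise estimate is applied to \<open>u\<close>, \<open>v\<close> and twice the norms of the indicator of \<open>B\<close>. Its three hypotheses fail only on small sets, because \<open>A1\<close>, \<open>A2\<close>,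
  \<open>A3\<close> below have integrals at most \<open>1\<close>, \<open>1\<close> and \<open>1 / (4 * N)\<close>. At points where one fails, the constant
  \<open>c\<close> to be bounded is at most \<open>c\<close> times the sum of the normalised quantities; on integration over \<open>E\<close>
  these error terms amount to at most \<open>3 / 4\<close> of the left-hand side and are absorbed. This
  is why \<open>F\<close> must have small modular, and why it suffices that \<open>E\<close> is a fixed fraction of \<open>B\<close>.
\<close>

lemma local_estimate:
  assumes n: "n \<ge> 1" and B: "B \<in> balls n"
    and p: "p \<in> exponents n" "proper_exponent n p" and q: "q \<in> exponents n" "proper_exponent n q"
    and pq: "AE x in leb n. p x \<le> q x"
    and E: "E \<in> sets (leb n)" "E \<subseteq> B" "measure (leb n) B \<le> N * measure (leb n) E" and N: "1 \<le> N"
    and FG: "F \<in> borel_measurable (leb n)" "G \<in> borel_measurable (leb n)"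
    and uv: "0 \<le> u" "0 \<le> v" "\<And>x. x \<in> B \<Longrightarrow> ennreal u \<le> F x" "\<And>x. x \<in> B \<Longrightarrow> ennreal v \<le> G x"
    and F: "modular n p F \<le> ennreal (1 / (4 * N))"
    and K: "0 < K" "lp_norm n q (indicator B) * lp_norm n (conj_exp p) (indicator B)
        \<le> ennreal (K * measure (leb n) B powr (1 - a))"
  shows "ennreal (measure (leb n) B powr a * u * v * measure (leb n) B)
    \<le> ennreal (64 * N\<^sup>2 * K) *
      (\<integral>\<^sup>+x\<in>E. ennpowr (F x) (enn2real (p x)) + ennpowr (G x) (enn2real (conj_exp q x)) \<partial>leb n)"
proof -
  note p' = proper_exponent_conj[OF p(2)] and q' = proper_exponent_conj[OF q(2)]
  note [measurable] = E(1) FG p(2)[THEN proper_exponent_measurable] q(2)[THEN proper_exponent_measurable]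
    p'[THEN proper_exponent_measurable] q'[THEN proper_exponent_measurable]
  have [measurable]: "B \<in> sets (leb n)" using B by simp
  define W where "W = measure (leb n) B"
  have W: "0 < W" using n B by (simp add: W_def measure_ball_pos)
  obtain l where l: "0 < l" "lp_norm n q (indicator B) = ennreal l"
    using lp_norm_indicator_real[OF n q B] .
  obtain m where m: "0 < m" "lp_norm n (conj_exp p) (indicator B) = ennreal m"
    using lp_norm_indicator_real[OF n conj_exp_exponents[OF p(1)] p' B] .
  have "ennreal (l * m) \<le> ennreal (K * W powr (1 - a))"
    using K l m by (simp add: W_def ennreal_mult)
  then have lm: "l * m \<le> K * W powr (1 - a)"
    using K W l m by (subst (asm) ennreal_le_iff) auto
  define A1 where "A1 x = ennpowr (indicator B x / ennreal (2 * l)) (enn2real (q x))" for x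
  define A2 where "A2 x = ennpowr (indicator B x / ennreal (2 * m)) (enn2real (conj_exp p x))" for x
  define A3 where "A3 x = ennpowr (F x) (enn2real (p x))" for x
  define A4 where "A4 x = ennpowr (G x) (enn2real (conj_exp q x))" for x
  have [measurable]: "A1 \<in> borel_measurable (leb n)" "A2 \<in> borel_measurable (leb n)"
    "A3 \<in> borel_measurable (leb n)" "A4 \<in> borel_measurable (leb n)"
    unfolding A1_def A2_def A3_def A4_def by measurable
  have A1: "(\<integral>\<^sup>+x. A1 x \<partial>leb n) \<le> 1"
    using modular_le_1[OF q(2), of "indicator B" "2 * l"] l q(2)
    by (simp add: A1_def modular_proper ennreal_less_iff)
  have A2: "(\<integral>\<^sup>+x. A2 x \<partial>leb n) \<le> 1"
    using modular_le_1[OF p', of "indicator B" "2 * m"] m p'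
    by (simp add: A2_def modular_proper ennreal_less_iff)
  have A3: "(\<integral>\<^sup>+x. A3 x \<partial>leb n) \<le> ennreal (1 / (4 * N))"
    using F p(2) by (simp add: A3_def modular_proper)
  define T where "T = 4 * N"
  have T: "1 \<le> T" using N by (simp add: T_def)
  define c where "c = W powr a * u * v"
  have c0: "0 \<le> c" using uv by (simp add: c_def)
  have point: "AE x in leb n. ennreal c * indicator E x
      \<le> ennreal (4 * K * T) * ((A3 x + A4 x) * indicator E x)
        + ennreal c * (ennreal (W / T) * A1 x + ennreal (W / T) * A2 x + ennreal W * A3 x)"
    using proper_exponent_AE[OF p(2)] proper_exponent_AE[OF q(2)] pq
  proof eventually_elim
    case (elim x)
    then obtain P Q where P: "1 < P" "p x = ennreal P" and Q: "1 < Q" "q x = ennreal Q" "P \<le> Q"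
      by (auto simp: ennreal_le_iff)
    show ?case
    proof (cases "x \<in> E")
      case True
      with E(2) have xB: "x \<in> B" by auto
      have inv: "1 / ennreal (2 * r) = ennreal (1 / (2 * r))" if "0 < r" for r
        using that divide_ennreal[of 1 "2 * r"] by simp
      have A1x: "A1 x = ennreal ((1 / (2 * l)) powr Q)"
        using xB Q l inv[of l] by (simp add: A1_def)
      have A2x: "A2 x = ennreal ((1 / (2 * m)) powr (P / (P - 1)))"
        using xB P m inv[of m] by (simp add: A2_def conj_exp_ennreal)
      have A3x: "ennreal (u powr P) \<le> A3 x"
        using ennpowr_mono[OF uv(3)[OF xB], of P] uv P by (simp add: A3_def)
      have A4x: "ennreal (v powr (Q / (Q - 1))) \<le> A4 x"
        using ennpowr_mono[OF uv(4)[OF xB], of "Q / (Q - 1)"] uv Q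
        by (simp add: A4_def conj_exp_ennreal)
      show ?thesis
      proof (cases "W * (1 / (2 * l)) powr Q \<le> T \<and> W * (1 / (2 * m)) powr (P / (P - 1)) \<le> T
          \<and> W * u powr P \<le> 1")
        case True
        have "c \<le> 4 * K * T * (u powr P + v powr (Q / (Q - 1)))"
          unfolding c_def
          by (rule pointwise_estimate[where l = "2 * l" and m = "2 * m"])
             (use True W l m K(1) T P Q uv lm in auto)
        then have "ennreal c \<le> ennreal (4 * K * T * (u powr P + v powr (Q / (Q - 1))))"
          by (rule ennreal_leI)
        also have "\<dots> = ennreal (4 * K * T) * (ennreal (u powr P) + ennreal (v powr (Q / (Q - 1))))"
          using K T by (simp add: ennreal_mult)
        also have "\<dots> \<le> ennreal (4 * K * T) * (A3 x + A4 x)"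
          by (intro mult_left_mono add_mono A3x A4x) simp
        finally show ?thesis
          using \<open>x \<in> E\<close> by (simp add: add_increasing2)
      next
        case False
        have "1 \<le> ennreal (W / T) * A1 x + ennreal (W / T) * A2 x + ennreal W * A3 x"
        proof -
          consider "T < W * (1 / (2 * l)) powr Q" | "T < W * (1 / (2 * m)) powr (P / (P - 1))"
            | "1 < W * u powr P"
            using False by linarith
          then show ?thesis
          proof cases
            case 1
            then have "1 \<le> W / T * (1 / (2 * l)) powr Q"
              using T by (simp add: field_simps)
            then have "1 \<le> ennreal (W / T * (1 / (2 * l)) powr Q)"
              by simp
            also have "\<dots> = ennreal (W / T) * A1 x"
              unfolding A1x using W T by (intro ennreal_mult) auto
            finally show ?thesis by (simp add: add_increasing2 add.assoc)
          next
            case 2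
            then have "1 \<le> W / T * (1 / (2 * m)) powr (P / (P - 1))"
              using T by (simp add: field_simps)
            then have "1 \<le> ennreal (W / T * (1 / (2 * m)) powr (P / (P - 1)))"
              by simp
            also have "\<dots> = ennreal (W / T) * A2 x"
              unfolding A2x using W T by (intro ennreal_mult) auto
            finally show ?thesis by (simp add: add_increasing2 add_increasing add.assoc)
          next
            case 3
            then have "1 \<le> ennreal (W * u powr P)"
              by simp
            also have "\<dots> \<le> ennreal W * A3 x"
              using W A3x by (simp add: ennreal_mult mult_left_mono)
            finally show ?thesis by (simp add: add_increasing)
          qed
        qed
        then have "ennreal c * 1 \<le> ennreal c * (ennreal (W / T) * A1 x + ennreal (W / T) * A2 x + ennreal W * A3 x)"
          by (rule mult_left_mono) simp
        then show ?thesis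
          using \<open>x \<in> E\<close> by (simp add: add_increasing)
      qed
    qed simp
  qed
  define J where "J = (\<integral>\<^sup>+x. (A3 x + A4 x) * indicator E x \<partial>leb n)"
  define V where "V = measure (leb n) E"
  have "emeasure (leb n) E \<le> emeasure (leb n) B"
    using E by (intro emeasure_mono) auto
  then have "emeasure (leb n) E < top"
    using n B by (auto intro: le_less_trans)
  then have V: "emeasure (leb n) E = ennreal V"
    by (simp add: V_def emeasure_eq_ennreal_measure less_top)
  have V0: "0 \<le> V" by (simp add: V_def)
  have WV: "W \<le> N * V" using E(3) by (simp add: W_def V_def)
  have "ennreal (c * V) = (\<integral>\<^sup>+x. ennreal c * indicator E x \<partial>leb n)"
    using c0 V V0 by (simp add: nn_integral_cmult ennreal_mult)
  also have "\<dots> \<le> (\<integral>\<^sup>+x. ennreal (4 * K * T) * ((A3 x + A4 x) * indicator E x)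
        + ennreal c * (ennreal (W / T) * A1 x + ennreal (W / T) * A2 x + ennreal W * A3 x) \<partial>leb n)"
    by (rule nn_integral_mono_AE[OF point])
  also have "\<dots> = ennreal (4 * K * T) * J + ennreal c * (ennreal (W / T) * (\<integral>\<^sup>+x. A1 x \<partial>leb n)
        + ennreal (W / T) * (\<integral>\<^sup>+x. A2 x \<partial>leb n) + ennreal W * (\<integral>\<^sup>+x. A3 x \<partial>leb n))"
    unfolding J_def by (simp add: nn_integral_add nn_integral_cmult)
  also have "\<dots> \<le> ennreal (4 * K * T) * J + ennreal c * (ennreal (W / T) * 1
        + ennreal (W / T) * 1 + ennreal W * ennreal (1 / (4 * N)))"
    by (intro add_left_mono mult_left_mono add_mono A1 A2 A3) auto
  also have "ennreal c * (ennreal (W / T) * 1 + ennreal (W / T) * 1 + ennreal W * ennreal (1 / (4 * N)))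
      = ennreal (c * (3 * W / (4 * N)))"
    using W N T c0 by (simp add: T_def field_simps flip: ennreal_mult ennreal_plus)
  finally have main: "ennreal (c * V) \<le> ennreal (4 * K * T) * J + ennreal (c * (3 * W / (4 * N)))" .
  \<comment> \<open>Absorb the last term of \<open>main\<close>; for this the integral \<open>J\<close> has to be finite.\<close>
  show ?thesis
  proof (cases J)
    case top
    then show ?thesis
      using N K by (simp add: J_def A3_def A4_def ennreal_mult_top)
  next
    case (real j)
    have "ennreal (c * V) \<le> ennreal (4 * K * T * j + c * (3 * W / (4 * N)))"
      using main real K T c0 W N by (simp flip: ennreal_mult ennreal_plus)
    then have "c * V \<le> 4 * K * T * j + c * (3 * W / (4 * N))"
      using real K T c0 W N by (subst (asm) ennreal_le_iff) auto
    also have "c * (3 * W / (4 * N)) \<le> c * (3 / 4 * V)"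
      using WV N c0 by (intro mult_left_mono) (auto simp: field_simps)
    finally have "c * V \<le> 64 * K * N * j"
      by (simp add: T_def)
    then have "N * (c * V) \<le> N * (64 * K * N * j)"
      using N by (intro mult_left_mono) auto
    moreover have "c * W \<le> c * (N * V)"
      using WV c0 by (rule mult_left_mono)
    ultimately have "c * W \<le> 64 * N\<^sup>2 * K * j"
      by (simp add: power2_eq_square algebra_simps)
    then have "ennreal (c * W) \<le> ennreal (64 * N\<^sup>2 * K * j)"
      by (rule ennreal_leI)
    also have "\<dots> = ennreal (64 * N\<^sup>2 * K) * J"
      using real K by (simp add: ennreal_mult)
    finally show ?thesis
      by (simp add: c_def W_def J_def A3_def A4_def)
  qed
qed

section \<open>Maximal functions\<close>

lemma maximal_eq:
  "maximal n f x = (SUP B\<in>balls n. (\<integral>\<^sup>+y\<in>B. ennreal \<bar>f y\<bar> \<partial>leb n) / emeasure (leb n) B * indicator B x)"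
  unfolding maximal_def by (simp add: divide_ennreal_def ac_simps)

lemma frac_maximal_eq:
  "frac_maximal n \<alpha> f x = (SUP B\<in>balls n. (\<integral>\<^sup>+y\<in>B. ennreal \<bar>f y\<bar> \<partial>leb n)
     / ennreal (measure (leb n) B powr (1 - avg n \<alpha> B)) * indicator B x)"
  unfolding frac_maximal_def by (simp add: divide_ennreal_def ac_simps)

lemma maximal_measurable [measurable]: "maximal n f \<in> borel_measurable (leb n)"
  unfolding maximal_eq[abs_def] by (rule SUP_balls_measurable)

lemma frac_maximal_measurable [measurable]: "frac_maximal n \<alpha> f \<in> borel_measurable (leb n)"
  unfolding frac_maximal_eq[abs_def] by (rule SUP_balls_measurable)

lemma nn_integral_scaled_abs:
  assumes "f \<in> borel_measurable (leb n)" "0 \<le> c" "B \<in> sets (leb n)"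
  shows "(\<integral>\<^sup>+y\<in>B. ennreal \<bar>c * f y\<bar> \<partial>leb n) = ennreal c * (\<integral>\<^sup>+y\<in>B. ennreal \<bar>f y\<bar> \<partial>leb n)"
proof -
  note [measurable] = assms(1,3)
  have "(\<integral>\<^sup>+y\<in>B. ennreal \<bar>c * f y\<bar> \<partial>leb n)
      = (\<integral>\<^sup>+y. ennreal c * (ennreal \<bar>f y\<bar> * indicator B y) \<partial>leb n)"
    using assms(2) by (simp add: abs_mult ennreal_mult mult.assoc)
  then show ?thesis
    by (simp add: nn_integral_cmult)
qed

lemma maximal_scale:
  assumes "f \<in> borel_measurable (leb n)" "0 \<le> c"
  shows "maximal n (\<lambda>y. c * f y) x = ennreal c * maximal n f x"
  unfolding maximal_eq SUP_mult_left_ennreal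
  by (intro SUP_cong)
     (simp_all add: nn_integral_scaled_abs[OF assms balls_sets] divide_ennreal_def mult.assoc)

lemma frac_maximal_scale:
  assumes "f \<in> borel_measurable (leb n)" "0 \<le> c"
  shows "frac_maximal n \<alpha> (\<lambda>y. c * f y) x = ennreal c * frac_maximal n \<alpha> f x"
  unfolding frac_maximal_eq SUP_mult_left_ennreal
  by (intro SUP_cong)
     (simp_all add: nn_integral_scaled_abs[OF assms balls_sets] divide_ennreal_def mult.assoc)

lemma mean_le_maximal:
  assumes "B \<in> balls n" "x \<in> B"
  shows "(\<integral>\<^sup>+y\<in>B. ennreal \<bar>f y\<bar> \<partial>leb n) / emeasure (leb n) B \<le> maximal n f x"
  unfolding maximal_eq using assms by (intro SUP_upper2[of B]) auto

lemma maximal_modular_imp_integral_finite: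
  assumes n: "n \<ge> 1" and s: "proper_exponent n s" and mod: "modular n s (maximal n f) < \<infinity>"
    and B: "B \<in> balls n"
  shows "(\<integral>\<^sup>+y\<in>B. ennreal \<bar>f y\<bar> \<partial>leb n) < \<infinity>"
proof (rule ccontr)
  assume "\<not> ?thesis"
  then have top: "(\<integral>\<^sup>+y\<in>B. ennreal \<bar>f y\<bar> \<partial>leb n) = top"
    by (simp add: less_top[symmetric])
  have [measurable]: "B \<in> sets (leb n)" using B by simp
  have mtop: "maximal n f x = top" if "x \<in> B" for x
    using mean_le_maximal[OF B that, of f] n B
    by (simp add: top ennreal_top_divide top_unique)
  have "(\<integral>\<^sup>+x. top * indicator B x \<partial>leb n) \<le> (\<integral>\<^sup>+x. ennpowr (maximal n f x) (enn2real (s x)) \<partial>leb n)"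
    by (intro nn_integral_mono) (auto simp: indicator_def mtop)
  also have "\<dots> = modular n s (maximal n f)"
    using s by (simp add: modular_proper)
  finally have "top * emeasure (leb n) B < \<infinity>"
    using mod by (simp add: nn_integral_cmult_indicator le_less_trans)
  moreover have "0 < emeasure (leb n) B"
    using measure_ball_pos[OF n B] n B by (simp add: emeasure_ball_eq_measure)
  ultimately show False
    by (simp add: ennreal_top_mult zero_less_iff_neq_zero)
qed

section \<open>Comparison of the powers of nested balls\<close>

text \<open>
  The mean of \<open>\<alpha>\<close> varies from ball to ball, so \<open>|B|\<close> to the power of its mean over \<open>B\<close> is not monotone
  in \<open>B\<close>. The norm of the indicator in the space with exponent \<open>1 / \<alpha>\<close> is monotone, and it dominates this power;
  the Muckenhoupt constant of \<open>1 / \<alpha>\<close> supplies the reverse bound, through the same lower bound for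
  the conjugate exponent \<open>1 / (1 - \<alpha>)\<close>. The case \<open>B = Q\<close> shows that this constant is at least
  \<open>1 / 4\<close>.
\<close>

lemma powr_avg_le_A_const:
  assumes n: "n \<ge> 1" and B: "B \<in> balls n" "Q \<in> balls n" "B \<subseteq> Q"
    and \<alpha>: "\<alpha> \<in> borel_measurable (leb n)" "\<And>x. x \<in> space (leb n) \<Longrightarrow> \<alpha> x \<le> 1"
    and A: "A_const n (\<lambda>x. 1 / \<alpha> x) \<le> ennreal A" "0 \<le> A"
  shows "measure (leb n) B powr avg n \<alpha> B \<le> 4 * A * measure (leb n) Q powr avg n \<alpha> Q"
proof -
  note [measurable] = \<alpha>(1)
  have [measurable]: "Q \<in> sets (leb n)" using B by simp
  let ?\<beta> = "\<lambda>x. 1 - \<alpha> x"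
  define W where "W = measure (leb n) Q"
  have W: "0 < W" "emeasure (leb n) Q = ennreal W"
    using n B by (simp_all add: W_def emeasure_ball_eq_measure measure_ball_pos)
  have fin: "(\<integral>\<^sup>+x\<in>Q. g x \<partial>leb n) < \<infinity>" if "\<And>x. x \<in> space (leb n) \<Longrightarrow> g x \<le> 1" for g :: "_ \<Rightarrow> ennreal"
  proof -
    have "(\<integral>\<^sup>+x\<in>Q. g x \<partial>leb n) \<le> (\<integral>\<^sup>+x. indicator Q x \<partial>leb n)"
      using that by (intro nn_integral_mono) (auto simp: indicator_def)
    then show ?thesis
      using W by (simp add: le_less_trans)
  qed
  have "avg n \<alpha> Q + avg n ?\<beta> Q = 1"
  proof -
    have "ennreal (avg n \<alpha> Q * W) + ennreal (avg n ?\<beta> Q * W)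
        = (\<integral>\<^sup>+x\<in>Q. \<alpha> x \<partial>leb n) + (\<integral>\<^sup>+x\<in>Q. ?\<beta> x \<partial>leb n)"
      using integral_avg[OF n B(2) \<alpha>(1) fin[OF \<alpha>(2)]] integral_avg[OF n B(2), of ?\<beta>] fin[of ?\<beta>]
      by (simp add: W_def diff_le_self_ennreal)
    also have "\<dots> = (\<integral>\<^sup>+x. \<alpha> x * indicator Q x + ?\<beta> x * indicator Q x \<partial>leb n)"
      by (intro nn_integral_add[symmetric]) auto
    also have "\<dots> = (\<integral>\<^sup>+x. indicator Q x \<partial>leb n)"
      using \<alpha>(2) by (intro nn_integral_cong) (auto simp: indicator_def add_diff_inverse_ennreal)
    also have "\<dots> = ennreal W"
      using W by simp
    finally have "avg n \<alpha> Q * W + avg n ?\<beta> Q * W = W"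
      using W avg_nonneg[of n \<alpha> Q] avg_nonneg[of n ?\<beta> Q] by (simp flip: ennreal_plus)
    then have "(avg n \<alpha> Q + avg n ?\<beta> Q) * W = 1 * W"
      by (simp add: algebra_simps)
    then show ?thesis using W by simp
  qed
  then have \<beta>_avg: "avg n ?\<beta> Q = 1 - avg n \<alpha> Q" by simp
  have conj: "conj_exp (\<lambda>x. 1 / \<alpha> x) = (\<lambda>x. 1 / ?\<beta> x)"
    by (simp add: conj_exp_def)
  let ?X = "lp_norm n (\<lambda>x. 1 / \<alpha> x) (indicator Q)" and ?Y = "lp_norm n (\<lambda>x. 1 / ?\<beta> x) (indicator Q)"
  have "ennreal (measure (leb n) B powr avg n \<alpha> B) \<le> 2 * ?X"
    using n B \<alpha> by (intro powr_avg_le_lp_norm) auto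
  moreover have "ennreal (W powr avg n ?\<beta> Q) \<le> 2 * ?Y"
    unfolding W_def using n B by (intro powr_avg_le_lp_norm) (auto simp: diff_le_self_ennreal)
  ultimately have "ennreal (measure (leb n) B powr avg n \<alpha> B) * ennreal (W powr avg n ?\<beta> Q)
      \<le> 2 * ?X * (2 * ?Y)"
    by (rule mult_mono) auto
  also have "\<dots> = 4 * (?X * ?Y)"
    by (simp add: ac_simps)
  also have "?X * ?Y \<le> ennreal (A * W)"
  proof -
    have "?X * ?Y / ennreal W \<le> A_const n (\<lambda>x. 1 / \<alpha> x)"
      unfolding A_const_def conj W(2)[symmetric] using B(2) by (intro SUP_upper)
    then have "?X * ?Y / ennreal W * ennreal W \<le> ennreal A * ennreal W"
      using A(1) by (intro mult_right_mono) auto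
    then show ?thesis
      using W A(2) by (simp add: ennreal_mult ennreal_divide_times)
  qed
  finally have "ennreal (measure (leb n) B powr avg n \<alpha> B * W powr avg n ?\<beta> Q) \<le> ennreal (4 * A * W)"
    using A(2) W by (simp add: ennreal_mult mult_left_mono mult.assoc)
  then have "measure (leb n) B powr avg n \<alpha> B * W powr (1 - avg n \<alpha> Q) \<le> 4 * A * W"
    using A(2) W by (simp add: ennreal_le_iff \<beta>_avg)
  then have "measure (leb n) B powr avg n \<alpha> B * W powr (1 - avg n \<alpha> Q) * W powr avg n \<alpha> Q
      \<le> 4 * A * W * W powr avg n \<alpha> Q"
    by (rule mult_right_mono) simp
  then have "measure (leb n) B powr avg n \<alpha> B * W \<le> 4 * A * W powr avg n \<alpha> Q * W"
    using W by (simp add: mult.assoc mult.commute[of W] flip: powr_add)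
  then show ?thesis
    using W by (simp add: W_def)
qed

section \<open>The bilinear estimate\<close>

definition bilinear_const :: "nat \<Rightarrow> real" where
  "bilinear_const n = 4096 * doubling n ^ 10"

text \<open>
  Passing to a sparse family costs one factor \<open>A\<close>, since the powers of a ball and of the larger
  selected ball have to be compared. The local estimates then add up, because the sets \<open>E i\<close> are
  disjoint, to the modulars of \<open>F\<close> and \<open>G\<close>, which stand for the maximal functions of \<open>\<phi>\<close> and \<open>\<gamma>\<close>.
\<close>

lemma finite_family_estimate:
  assumes n: "n \<ge> 1"
    and p: "p \<in> exponents n" "proper_exponent n p" and q: "q \<in> exponents n" "proper_exponent n q"
    and pq: "AE x in leb n. p x \<le> q x"
    and \<alpha>: "\<alpha> \<in> borel_measurable (leb n)" "\<And>x. x \<in> space (leb n) \<Longrightarrow> \<alpha> x \<le> 1"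
    and K: "0 < K" "A_frac_const n p q \<alpha> \<le> ennreal K"
    and A: "0 < A" "A_const n (\<lambda>x. 1 / \<alpha> x) \<le> ennreal A"
    and \<phi>: "\<phi> \<in> borel_measurable (leb n)" "(\<integral>\<^sup>+x. \<phi> x \<partial>leb n) < \<infinity>"
    and \<gamma>: "\<gamma> \<in> borel_measurable (leb n)" "\<And>B. B \<in> balls n \<Longrightarrow> (\<integral>\<^sup>+x\<in>B. \<gamma> x \<partial>leb n) < \<infinity>"
    and FG: "F \<in> borel_measurable (leb n)" "G \<in> borel_measurable (leb n)"
    and dom: "\<And>B x. B \<in> balls n \<Longrightarrow> x \<in> B \<Longrightarrow> ennreal (avg n \<phi> B) \<le> F x"
      "\<And>B x. B \<in> balls n \<Longrightarrow> x \<in> B \<Longrightarrow> ennreal (avg n \<gamma> B) \<le> G x"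
    and F: "modular n p F \<le> ennreal (1 / (8 * (doubling n)\<^sup>2))" and G: "modular n (conj_exp q) G \<le> 1"
    and \<F>: "finite \<F>" "\<F> \<subseteq> balls n"
  shows "(\<integral>\<^sup>+x. (SUP B\<in>\<F>. ennreal (measure (leb n) B powr avg n \<alpha> B * avg n \<phi> B) * indicator B x) * \<gamma> x \<partial>leb n)
    \<le> ennreal (bilinear_const n * K * A)"
proof -
  define D where "D = doubling n"
  have D: "1 \<le> D" using n by (simp add: D_def doubling_ge_1)
  note q' = proper_exponent_conj[OF q(2)]
  note [measurable] = \<phi>(1) \<gamma>(1) FG p(2)[THEN proper_exponent_measurable] q'[THEN proper_exponent_measurable]
  obtain I :: "((nat \<Rightarrow> real) \<times> real) set" and Q E where I: "finite I"
    "\<And>i. i \<in> I \<Longrightarrow> Q i \<in> balls n" "\<And>i. i \<in> I \<Longrightarrow> E i \<in> sets (leb n)" "\<And>i. i \<in> I \<Longrightarrow> E i \<subseteq> Q i"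
    "\<And>i. i \<in> I \<Longrightarrow> measure (leb n) (Q i) \<le> 2 * (doubling n)\<^sup>2 * measure (leb n) (E i)"
    "disjoint_family_on E I"
    "\<And>B. B \<in> \<F> \<Longrightarrow> 0 < avg n \<phi> B \<Longrightarrow> \<exists>i\<in>I. B \<subseteq> Q i \<and> avg n \<phi> B \<le> 2 * doubling n ^ 6 * avg n \<phi> (Q i)"
    by (rule sparse_selection[OF n \<phi> \<F>]) (rule that)
  define w where "w B = measure (leb n) B powr avg n \<alpha> B * avg n \<phi> B" for B
  have w0: "0 \<le> w B" for B by (simp add: w_def avg_nonneg)
  \<comment> \<open>\<open>4 * A\<close> from the powers of the measures, \<open>2 * D ^ 6\<close> from the means.\<close>
  define M where "M = 8 * A * D ^ 6"
  have M0: "0 \<le> M" using A D by (simp add: M_def)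
  have sup_le: "(SUP B\<in>\<F>. ennreal (w B) * indicator B x) \<le> (\<Sum>i\<in>I. ennreal (M * w (Q i)) * indicator (Q i) x)" for x
  proof (rule SUP_least)
    fix B assume B: "B \<in> \<F>"
    show "ennreal (w B) * indicator B x \<le> (\<Sum>i\<in>I. ennreal (M * w (Q i)) * indicator (Q i) x)"
    proof (cases "x \<in> B \<and> 0 < avg n \<phi> B")
      case True
      then obtain i where i: "i \<in> I" "B \<subseteq> Q i" "avg n \<phi> B \<le> 2 * D ^ 6 * avg n \<phi> (Q i)"
        using I(7)[OF B] by (auto simp: D_def)
      have "measure (leb n) B powr avg n \<alpha> B \<le> 4 * A * measure (leb n) (Q i) powr avg n \<alpha> (Q i)"
        using B \<F> I(2)[OF i(1)] A by (intro powr_avg_le_A_const n i \<alpha>) auto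
      then have "w B \<le> (4 * A * measure (leb n) (Q i) powr avg n \<alpha> (Q i)) * (2 * D ^ 6 * avg n \<phi> (Q i))"
        unfolding w_def using i(3) A by (intro mult_mono) (auto simp: avg_nonneg)
      also have "\<dots> = M * w (Q i)"
        by (simp add: M_def w_def)
      finally have "ennreal (w B) * indicator B x \<le> ennreal (M * w (Q i)) * indicator (Q i) x"
        using True i(2) by (auto simp: indicator_def intro: ennreal_leI)
      also have "\<dots> \<le> (\<Sum>i\<in>I. ennreal (M * w (Q i)) * indicator (Q i) x)"
        using I(1) i(1) by (intro member_le_sum) auto
      finally show ?thesis .
    next
      case False
      then have "ennreal (w B) * indicator B x = 0"
        using avg_nonneg[of n \<phi> B] by (auto simp: w_def indicator_def)
      then show ?thesis by (simp only: zero_le)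
    qed
  qed
  define H where "H x = ennpowr (F x) (enn2real (p x)) + ennpowr (G x) (enn2real (conj_exp q x))" for x
  have [measurable]: "H \<in> borel_measurable (leb n)"
    unfolding H_def by measurable
  define c where "c = 64 * (2 * D\<^sup>2)\<^sup>2 * K"
  have c0: "0 \<le> c" using K by (simp add: c_def)
  have local: "ennreal (w (Q i)) * (\<integral>\<^sup>+x\<in>Q i. \<gamma> x \<partial>leb n) \<le> ennreal c * (\<integral>\<^sup>+x\<in>E i. H x \<partial>leb n)" if i: "i \<in> I" for i
  proof -
    let ?W = "measure (leb n) (Q i)" and ?a = "avg n \<alpha> (Q i)"
    have Q: "Q i \<in> balls n" by (rule I(2)[OF i])
    have W: "0 < ?W" by (rule measure_ball_pos[OF n Q])
    have "ennreal (w (Q i)) * (\<integral>\<^sup>+x\<in>Q i. \<gamma> x \<partial>leb n)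
        = ennreal (?W powr ?a * avg n \<phi> (Q i) * avg n \<gamma> (Q i) * ?W)"
      using integral_avg[OF n Q \<gamma>(1) \<gamma>(2)[OF Q]] w0
      by (simp add: w_def mult.assoc avg_nonneg flip: ennreal_mult)
    also have "\<dots> \<le> ennreal (64 * (2 * D\<^sup>2)\<^sup>2 * K) * (\<integral>\<^sup>+x\<in>E i. H x \<partial>leb n)"
      unfolding H_def
    proof (rule local_estimate[OF n Q p q pq I(3,4)[OF i] _ _ FG avg_nonneg avg_nonneg dom(1)[OF Q] dom(2)[OF Q] _ K(1)])
      show "?W \<le> 2 * D\<^sup>2 * measure (leb n) (E i)"
        using I(5)[OF i] by (simp add: D_def)
      show "1 \<le> 2 * D\<^sup>2"
        using one_le_power[OF D, of 2] by simp
      show "modular n p F \<le> ennreal (1 / (4 * (2 * D\<^sup>2)))"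
        using F by (simp add: D_def)
      let ?X = "lp_norm n q (indicator (Q i)) * lp_norm n (conj_exp p) (indicator (Q i))"
      have "?X / ennreal (?W powr (1 - ?a)) \<le> A_frac_const n p q \<alpha>"
        unfolding A_frac_const_def using Q by (intro SUP_upper)
      then have "?X / ennreal (?W powr (1 - ?a)) * ennreal (?W powr (1 - ?a)) \<le> ennreal K * ennreal (?W powr (1 - ?a))"
        using K(2) by (intro mult_right_mono) auto
      then show "?X \<le> ennreal (K * ?W powr (1 - ?a))"
        using W K(1) by (simp add: ennreal_mult ennreal_divide_times)
    qed
    finally show ?thesis by (simp add: c_def)
  qed
  have [measurable]: "Q i \<in> sets (leb n)" "E i \<in> sets (leb n)" if "i \<in> I" for i
    using I(2,3)[OF that] by auto
  have "(\<integral>\<^sup>+x. (SUP B\<in>\<F>. ennreal (w B) * indicator B x) * \<gamma> x \<partial>leb n)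
      \<le> (\<integral>\<^sup>+x. (\<Sum>i\<in>I. ennreal (M * w (Q i)) * (\<gamma> x * indicator (Q i) x)) \<partial>leb n)"
  proof (rule nn_integral_mono)
    fix x
    have "(SUP B\<in>\<F>. ennreal (w B) * indicator B x) * \<gamma> x
        \<le> (\<Sum>i\<in>I. ennreal (M * w (Q i)) * indicator (Q i) x) * \<gamma> x"
      by (intro mult_right_mono sup_le) simp
    then show "(SUP B\<in>\<F>. ennreal (w B) * indicator B x) * \<gamma> x
        \<le> (\<Sum>i\<in>I. ennreal (M * w (Q i)) * (\<gamma> x * indicator (Q i) x))"
      by (simp add: sum_distrib_left ac_simps)
  qed
  also have "\<dots> = (\<Sum>i\<in>I. ennreal (M * w (Q i)) * (\<integral>\<^sup>+x\<in>Q i. \<gamma> x \<partial>leb n))"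
    by (subst nn_integral_sum) (auto intro!: sum.cong nn_integral_cmult)
  also have "\<dots> = (\<Sum>i\<in>I. ennreal M * (ennreal (w (Q i)) * (\<integral>\<^sup>+x\<in>Q i. \<gamma> x \<partial>leb n)))"
    using M0 w0 by (intro sum.cong) (auto simp: ennreal_mult mult.assoc)
  also have "\<dots> \<le> (\<Sum>i\<in>I. ennreal M * (ennreal c * (\<integral>\<^sup>+x\<in>E i. H x \<partial>leb n)))"
    by (intro sum_mono mult_left_mono local) auto
  also have "\<dots> = ennreal M * ennreal c * (\<Sum>i\<in>I. (\<integral>\<^sup>+x\<in>E i. H x \<partial>leb n))"
    by (simp add: sum_distrib_left mult.assoc)
  also have "(\<Sum>i\<in>I. (\<integral>\<^sup>+x\<in>E i. H x \<partial>leb n)) = (\<integral>\<^sup>+x. (\<Sum>i\<in>I. H x * indicator (E i) x) \<partial>leb n)"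
    by (intro nn_integral_sum[symmetric]) auto
  also have "\<dots> = (\<integral>\<^sup>+x. H x * indicator (\<Union>i\<in>I. E i) x \<partial>leb n)"
    using I(1,6) by (simp add: indicator_UN_disjoint sum_distrib_left)
  also have "\<dots> \<le> (\<integral>\<^sup>+x. H x \<partial>leb n)"
    by (intro nn_integral_mono) (auto simp: indicator_def)
  also have "\<dots> = modular n p F + modular n (conj_exp q) G"
    unfolding H_def using p q' FG by (simp add: nn_integral_add modular_proper)
  also have "\<dots> \<le> ennreal 1 + 1"
  proof (rule add_mono[OF _ G])
    have "1 / (8 * (doubling n)\<^sup>2) \<le> 1"
    proof -
      have "1 \<le> 8 * (doubling n)\<^sup>2"
        using one_le_power[OF D, of 2] unfolding D_def by linarith
      then show ?thesis by (intro divide_le_eq_1_pos[THEN iffD2]) linarith+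
    qed
    then show "modular n p F \<le> ennreal 1"
      using F by (meson ennreal_leI order_trans)
  qed
  also have "ennreal M * ennreal c * (ennreal 1 + 1) = ennreal (bilinear_const n * K * A)"
  proof -
    have "ennreal M * ennreal c * (ennreal 1 + 1) = ennreal (M * c * 2)"
      using M0 c0 by (simp add: ennreal_mult)
    also have "M * c * 2 = bilinear_const n * K * A"
      by (simp add: M_def c_def bilinear_const_def D_def power_mult_distrib flip: power_mult power_add)
    finally show ?thesis .
  qed
  finally show ?thesis
    by (simp add: w_def mult_left_mono)
qed

lemma divide_one_ennreal [simp]: "x / 1 = (x :: ennreal)"
  by (simp add: divide_ennreal_def)

text \<open>
  Monotone convergence in two respects at once: the balls are restricted to finitely many, and
  \<open>f\<close> to a large ball, which makes it integrable over the whole space as the selection requires. Each single ball is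
  unaffected by the second restriction once the large ball contains it.
\<close>

lemma bilinear_estimate:
  assumes n: "n \<ge> 1"
    and p: "p \<in> exponents n" "proper_exponent n p" and q: "q \<in> exponents n" "proper_exponent n q"
    and pq: "AE x in leb n. p x \<le> q x"
    and \<alpha>: "\<alpha> \<in> borel_measurable (leb n)" "\<And>x. x \<in> space (leb n) \<Longrightarrow> \<alpha> x \<le> 1"
    and K: "0 < K" "A_frac_const n p q \<alpha> \<le> ennreal K"
    and A: "0 < A" "A_const n (\<lambda>x. 1 / \<alpha> x) \<le> ennreal A"
    and f: "f \<in> borel_measurable (leb n)" and g: "g \<in> borel_measurable (leb n)"
    and F: "modular n p (maximal n f) \<le> ennreal (1 / (8 * (doubling n)\<^sup>2))"
    and G: "modular n (conj_exp q) (maximal n g) \<le> 1"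
  shows "(\<integral>\<^sup>+x. frac_maximal n \<alpha> f x * ennreal \<bar>g x\<bar> \<partial>leb n) \<le> ennreal (bilinear_const n * K * A)"
proof -
  note [measurable] = f g
  note q' = proper_exponent_conj[OF q(2)]
  define W where "W B = (\<integral>\<^sup>+y\<in>B. ennreal \<bar>f y\<bar> \<partial>leb n) / ennreal (measure (leb n) B powr (1 - avg n \<alpha> B))" for B
  obtain \<V> where \<V>: "\<V> \<subseteq> balls n" "countable \<V>" "\<V> \<noteq> {}"
    "\<And>x. (SUP B\<in>balls n. W B * indicator B x) = (SUP B\<in>\<V>. W B * indicator B x)"
    by (rule SUP_balls_countable[of n W]) (rule that)
  define V where "V = from_nat_into \<V>"
  have V_range: "range V = \<V>"
    unfolding V_def using \<V>(2,3) by (rule range_from_nat_into[rotated])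
  then have V_balls: "V i \<in> balls n" for i
    using \<V>(1) by auto
  define z :: "nat \<Rightarrow> real" where "z = (\<lambda>i\<in>{..<n}. 0)"
  have z: "z \<in> space (leb n)" by (auto simp: z_def space_leb)
  define \<phi> where "\<phi> m y = ennreal \<bar>f y\<bar> * indicator (eucl_ball n z (real m + 1)) y" for m y
  have [measurable]: "\<phi> m \<in> borel_measurable (leb n)" for m
    unfolding \<phi>_def by measurable
  have f_fin: "(\<integral>\<^sup>+y\<in>B. ennreal \<bar>f y\<bar> \<partial>leb n) < \<infinity>" if "B \<in> balls n" for B
    using maximal_modular_imp_integral_finite[OF n p(2) le_less_trans[OF F] that] by simp
  have g_fin: "(\<integral>\<^sup>+y\<in>B. ennreal \<bar>g y\<bar> \<partial>leb n) < \<infinity>" if "B \<in> balls n" for B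
    using maximal_modular_imp_integral_finite[OF n q' le_less_trans[OF G] that] by simp
  have \<phi>_fin: "(\<integral>\<^sup>+y. \<phi> m y \<partial>leb n) < \<infinity>" for m
    unfolding \<phi>_def using z by (intro f_fin ballsI) auto
  have \<phi>_le: "(\<integral>\<^sup>+y\<in>B. \<phi> m y \<partial>leb n) \<le> (\<integral>\<^sup>+y\<in>B. ennreal \<bar>f y\<bar> \<partial>leb n)" for B m
    by (intro nn_integral_mono) (auto simp: \<phi>_def indicator_def)
  have avg_mean: "ennreal (avg n h B) = (\<integral>\<^sup>+y\<in>B. h y \<partial>leb n) / emeasure (leb n) B"
    if "B \<in> balls n" "h \<in> borel_measurable (leb n)" "(\<integral>\<^sup>+y\<in>B. h y \<partial>leb n) < \<infinity>" for h B
  proof -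
    have "0 < measure (leb n) B" using n that(1) by (rule measure_ball_pos)
    then show ?thesis
      using integral_avg[OF n that] n that(1)
      by (simp add: emeasure_ball_eq_measure divide_ennreal avg_nonneg)
  qed
  define w where "w m B = ennreal (measure (leb n) B powr avg n \<alpha> B * avg n (\<phi> m) B)" for m B
  have w_eq: "w m B = (\<integral>\<^sup>+y\<in>B. \<phi> m y \<partial>leb n) / ennreal (measure (leb n) B powr (1 - avg n \<alpha> B))"
    if B: "B \<in> balls n" for m B
  proof -
    have pos: "0 < measure (leb n) B" using n B by (rule measure_ball_pos)
    have "measure (leb n) B powr avg n \<alpha> B * measure (leb n) B powr (1 - avg n \<alpha> B) = measure (leb n) B"
      using pos by (simp flip: powr_add)
    then have "avg n (\<phi> m) B * measure (leb n) B / measure (leb n) B powr (1 - avg n \<alpha> B)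
        = measure (leb n) B powr avg n \<alpha> B * avg n (\<phi> m) B"
      using pos by (simp add: field_simps)
    then show ?thesis
      using integral_avg[OF n B _ le_less_trans[OF \<phi>_le f_fin[OF B]], of m] pos
      by (simp add: w_def divide_ennreal avg_nonneg)
  qed
  have w_le: "w m B \<le> W B" if "B \<in> balls n" for m B
    unfolding w_eq[OF that] W_def by (rule divide_right_mono_ennreal[OF \<phi>_le])
  have w_mono: "w m B \<le> w m' B" if "B \<in> balls n" "m \<le> m'" for m m' B
  proof -
    have "eucl_ball n z (real m + 1) \<subseteq> eucl_ball n z (real m' + 1)"
      using that(2) by (intro eucl_ball_subset) simp
    then show ?thesis
      unfolding w_eq[OF that(1)] \<phi>_def
      by (intro divide_right_mono_ennreal nn_integral_mono) (auto simp: indicator_def)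
  qed
  have w_eventually: "\<exists>M. \<forall>m\<ge>M. w m B = W B" if B: "B \<in> balls n" for B
  proof -
    obtain c r where cr: "B = eucl_ball n c r" "c \<in> space (leb n)" "0 < r"
      using B by (rule ballsE)
    obtain M :: nat where M: "edist n c z + r \<le> real M"
      using real_arch_simple by blast
    have "w m B = W B" if "M \<le> m" for m
    proof -
      have "edist n c z + r \<le> real m + 1"
        using M that by linarith
      then have "B \<subseteq> eucl_ball n z (real m + 1)"
        unfolding cr(1) by (rule eucl_ball_subset)
      then have "(\<integral>\<^sup>+y\<in>B. \<phi> m y \<partial>leb n) = (\<integral>\<^sup>+y\<in>B. ennreal \<bar>f y\<bar> \<partial>leb n)"
        by (intro nn_integral_cong) (auto simp: \<phi>_def indicator_def)
      then show ?thesis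
        by (simp add: w_eq[OF B] W_def)
    qed
    then show ?thesis by blast
  qed
  define h where "h m x = (SUP B\<in>V ` {..m}. w m B * indicator B x)" for m x
  have [measurable]: "h m \<in> borel_measurable (leb n)" for m
    unfolding h_def
  proof (rule borel_measurable_SUP)
    fix B assume "B \<in> V ` {..m}"
    then have [measurable]: "B \<in> sets (leb n)" using V_balls by auto
    show "(\<lambda>x. w m B * indicator B x) \<in> borel_measurable (leb n)" by measurable
  qed (simp add: countable_finite)
  have frac: "frac_maximal n \<alpha> f x \<le> (SUP m. h m x)" for x
  proof -
    have "frac_maximal n \<alpha> f x = (SUP B\<in>balls n. W B * indicator B x)"
      by (simp only: frac_maximal_eq W_def)
    also have "\<dots> = (SUP B\<in>\<V>. W B * indicator B x)"
      by (rule \<V>(4))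
    also have "\<dots> \<le> (SUP m. h m x)"
    proof (rule SUP_least)
      fix B assume "B \<in> \<V>"
      then obtain i where i: "B = V i" using V_range by auto
      obtain M where M: "\<forall>m\<ge>M. w m (V i) = W (V i)"
        using w_eventually[OF V_balls] by blast
      have "W B * indicator B x = w (max M i) (V i) * indicator (V i) x"
        using M i by simp
      also have "\<dots> \<le> h (max M i) x"
        unfolding h_def by (intro SUP_upper) auto
      also have "\<dots> \<le> (SUP m. h m x)"
        by (intro SUP_upper) auto
      finally show "W B * indicator B x \<le> (SUP m. h m x)" .
    qed
    finally show ?thesis .
  qed
  have h_mono: "h m x \<le> h (Suc m) x" for m x
    unfolding h_def
  proof (rule SUP_mono)
    fix B assume B: "B \<in> V ` {..m}"
    then have "B \<in> V ` {..Suc m}" by auto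
    moreover have "w m B * indicator B x \<le> w (Suc m) B * indicator B x"
      using B V_balls by (intro mult_right_mono w_mono) auto
    ultimately show "\<exists>B'\<in>V ` {..Suc m}. w m B * indicator B x \<le> w (Suc m) B' * indicator B' x"
      by blast
  qed
  have "(\<integral>\<^sup>+x. frac_maximal n \<alpha> f x * ennreal \<bar>g x\<bar> \<partial>leb n)
      \<le> (\<integral>\<^sup>+x. (SUP m. h m x * ennreal \<bar>g x\<bar>) \<partial>leb n)"
  proof (rule nn_integral_mono)
    fix x
    have "frac_maximal n \<alpha> f x * ennreal \<bar>g x\<bar> \<le> (SUP m. h m x) * ennreal \<bar>g x\<bar>"
      by (intro mult_right_mono frac) simp
    then show "frac_maximal n \<alpha> f x * ennreal \<bar>g x\<bar> \<le> (SUP m. h m x * ennreal \<bar>g x\<bar>)"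
      by (simp add: SUP_mult_right_ennreal)
  qed
  also have "\<dots> = (SUP m. (\<integral>\<^sup>+x. h m x * ennreal \<bar>g x\<bar> \<partial>leb n))"
    using h_mono by (intro nn_integral_monotone_convergence_SUP)
      (auto simp: incseq_Suc_iff le_fun_def intro: mult_right_mono)
  also have "\<dots> \<le> ennreal (bilinear_const n * K * A)"
  proof (rule SUP_least)
    fix m
    show "(\<integral>\<^sup>+x. h m x * ennreal \<bar>g x\<bar> \<partial>leb n) \<le> ennreal (bilinear_const n * K * A)"
      unfolding h_def w_def
    proof (rule finite_family_estimate[OF n p q pq \<alpha> K A _ \<phi>_fin _ g_fin
          maximal_measurable maximal_measurable _ _ F G])
      fix B x assume Bx: "B \<in> balls n" "x \<in> B"
      have "ennreal (avg n (\<phi> m) B) = (\<integral>\<^sup>+y\<in>B. \<phi> m y \<partial>leb n) / emeasure (leb n) B"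
        using Bx(1) le_less_trans[OF \<phi>_le f_fin[OF Bx(1)]] by (intro avg_mean) auto
      also have "\<dots> \<le> (\<integral>\<^sup>+y\<in>B. ennreal \<bar>f y\<bar> \<partial>leb n) / emeasure (leb n) B"
        by (rule divide_right_mono_ennreal[OF \<phi>_le])
      also have "\<dots> \<le> maximal n f x"
        by (rule mean_le_maximal[OF Bx])
      finally show "ennreal (avg n (\<phi> m) B) \<le> maximal n f x" .
      have "ennreal (avg n (\<lambda>y. ennreal \<bar>g y\<bar>) B) = (\<integral>\<^sup>+y\<in>B. ennreal \<bar>g y\<bar> \<partial>leb n) / emeasure (leb n) B"
        using Bx(1) g_fin by (intro avg_mean) auto
      also have "\<dots> \<le> maximal n g x"
        by (rule mean_le_maximal[OF Bx])
      finally show "ennreal (avg n (\<lambda>y. ennreal \<bar>g y\<bar>) B) \<le> maximal n g x" .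
    qed (use V_balls in auto)
  qed
  finally show ?thesis .
qed

section \<open>Positivity of the constants\<close>

text \<open>
  All factors on the right-hand side of the upper bound are positive, so the product is infinite
  as soon as one of them is.
\<close>

lemma op_norm_maximal_pos:
  assumes n: "n \<ge> 1" and s: "s \<in> exponents n" "proper_exponent n s"
  shows "0 < op_norm n s s (maximal n)"
proof -
  define B where "B = eucl_ball n (\<lambda>i\<in>{..<n}. 0) 1"
  have B: "B \<in> balls n"
    unfolding B_def by (intro ballsI) (auto simp: space_leb)
  have [measurable]: "B \<in> sets (leb n)" using B by simp
  obtain r where r: "0 < r" "lp_norm n s (indicator B) = ennreal r"
    using lp_norm_indicator_real[OF n s B] .
  define f :: "(nat \<Rightarrow> real) \<Rightarrow> real" where "f = indicator B"
  have f: "(\<lambda>x. ennreal \<bar>f x\<bar>) = indicator B"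
    by (auto simp: f_def indicator_def)
  have W: "0 < emeasure (leb n) B" "emeasure (leb n) B < top"
    using measure_ball_pos[OF n B] n B by (simp_all add: emeasure_ball_eq_measure)
  have "(indicator B x :: ennreal) \<le> maximal n f x" for x
  proof (cases "x \<in> B")
    case True
    have "(\<integral>\<^sup>+y\<in>B. ennreal \<bar>f y\<bar> \<partial>leb n) = (\<integral>\<^sup>+y. indicator B y \<partial>leb n)"
      by (intro nn_integral_cong) (auto simp: f_def indicator_def)
    then show ?thesis
      using mean_le_maximal[OF B True, of f] True W by (simp add: zero_less_iff_neq_zero)
  qed simp
  then have "lp_norm n s (indicator B) \<le> lp_norm n s (maximal n f)"
    using s(2) by (intro lp_norm_mono) auto
  also have "\<dots> \<le> op_norm n s s (maximal n) * ennreal r"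
  proof (rule op_normD)
    show "f \<in> borel_measurable (leb n)" unfolding f_def by measurable
    show "lp_norm n s (\<lambda>x. ennreal \<bar>f x\<bar>) \<le> ennreal r" using r by (simp only: f order_refl)
  qed (use r in simp)
  finally show ?thesis
    using r by (auto simp: zero_less_iff_neq_zero)
qed

lemma A_frac_const_pos:
  assumes n: "n \<ge> 1" and p: "p \<in> exponents n" and q: "q \<in> exponents n"
  shows "0 < A_frac_const n p q \<alpha>"
proof -
  define B where "B = eucl_ball n (\<lambda>i\<in>{..<n}. 0) 1"
  have B: "B \<in> balls n"
    unfolding B_def by (intro ballsI) (auto simp: space_leb)
  have "0 < lp_norm n q (indicator B) * lp_norm n (conj_exp p) (indicator B)
      / ennreal (measure (leb n) B powr (1 - avg n \<alpha> B))"
    using lp_norm_indicator_pos[OF n q B] lp_norm_indicator_pos[OF n conj_exp_exponents[OF p] B]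
    by (simp add: ennreal_zero_less_divide ennreal_zero_less_mult_iff)
  also have "\<dots> \<le> A_frac_const n p q \<alpha>"
    unfolding A_frac_const_def using B by (intro SUP_upper)
  finally show ?thesis .
qed

lemma A_const_ge:
  assumes n: "n \<ge> 1" and \<alpha>: "\<alpha> \<in> borel_measurable (leb n)" "\<And>x. x \<in> space (leb n) \<Longrightarrow> \<alpha> x \<le> 1"
  shows "ennreal (1 / 4) \<le> A_const n (\<lambda>x. 1 / \<alpha> x)"
proof (cases "A_const n (\<lambda>x. 1 / \<alpha> x)")
  case (real A)
  define B where "B = eucl_ball n (\<lambda>i\<in>{..<n}. 0) 1"
  have B: "B \<in> balls n"
    unfolding B_def by (intro ballsI) (auto simp: space_leb)
  have "measure (leb n) B powr avg n \<alpha> B \<le> 4 * A * measure (leb n) B powr avg n \<alpha> B"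
    using real by (intro powr_avg_le_A_const n B \<alpha>) auto
  then have "1 \<le> 4 * A"
    using measure_ball_pos[OF n B] by simp
  then show ?thesis
    using real by (simp add: ennreal_leI)
qed simp

section \<open>The two inequalities\<close>

text \<open>
  For \<open>t\<close> below the norm of the indicator of \<open>B\<close> in the space with exponent \<open>conj_exp p\<close>, duality gives
  \<open>g\<close> in the unit ball with exponent \<open>p\<close> whose integral over \<open>B\<close> is at least \<open>t\<close>. Its fractional maximal function is
  at least \<open>t / w\<close> on \<open>B\<close>.
\<close>

lemma A_frac_const_le_op_norm:
  assumes n: "n \<ge> 1" and p: "p \<in> exponents n" "proper_exponent n p"
    and q: "q \<in> exponents n" "proper_exponent n q"
  shows "A_frac_const n p q \<alpha> \<le> op_norm n p q (frac_maximal n \<alpha>)"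
  unfolding A_frac_const_def
proof (rule SUP_least)
  fix B assume B: "B \<in> balls n"
  note p' = proper_exponent_conj[OF p(2)]
  have [measurable]: "B \<in> sets (leb n)" using B by simp
  let ?T = "op_norm n p q (frac_maximal n \<alpha>)"
  define w where "w = measure (leb n) B powr (1 - avg n \<alpha> B)"
  have w: "0 < w" using measure_ball_pos[OF n B] by (simp add: w_def)
  obtain x where x: "0 < x" "lp_norm n q (indicator B) = ennreal x"
    using lp_norm_indicator_real[OF n q B] .
  let ?Y = "lp_norm n (conj_exp p) (indicator B)"
  have test: "ennreal (x / w) * ennreal t \<le> ?T" if t: "0 < t" "ennreal t < ?Y" for t
  proof -
    have "1 < modular n (conj_exp p) (\<lambda>y. indicator B y / ennreal t)"
      using lp_norm_le[OF t(1), of n "conj_exp p" "indicator B"] t(2) by (meson leD leI)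
    then obtain g :: "(nat \<Rightarrow> real) \<Rightarrow> real" where g: "g \<in> borel_measurable (leb n)" "\<And>y. 0 \<le> g y"
      "modular n (conj_exp (conj_exp p)) (\<lambda>y. ennreal (g y)) \<le> 1"
      "ennreal t \<le> (\<integral>\<^sup>+y. indicator B y * ennreal (g y) \<partial>leb n)"
      by (rule dual_witness[OF p' _ n t(1), rotated]) (auto intro: that)
    note [measurable] = g(1)
    have "modular n (conj_exp (conj_exp p)) (\<lambda>y. ennreal (g y)) = modular n p (\<lambda>y. ennreal (g y))"
      using p proper_exponent_conj[OF p'] conj_exp_conj_exp[of p]
      by (auto simp: modular_proper exponents_def intro!: nn_integral_cong)
    then have "modular n p (\<lambda>y. ennreal \<bar>g y\<bar> / ennreal 1) \<le> 1"
      using g(2,3) by simp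
    then have "lp_norm n p (\<lambda>y. ennreal \<bar>g y\<bar>) \<le> ennreal 1"
      by (intro lp_norm_le) auto
    then have 1: "lp_norm n q (frac_maximal n \<alpha> g) \<le> ?T"
      using op_normD[of g n p 1 q "frac_maximal n \<alpha>"] g(1) by simp
    have "ennreal (t / w) * indicator B y \<le> frac_maximal n \<alpha> g y" for y
    proof (cases "y \<in> B")
      case True
      have "ennreal (t / w) = ennreal t / ennreal w"
        using t w by (simp add: divide_ennreal)
      also have "\<dots> \<le> (\<integral>\<^sup>+y\<in>B. ennreal \<bar>g y\<bar> \<partial>leb n) / ennreal w"
        using g(2,4) by (intro divide_right_mono_ennreal) (simp add: mult.commute)
      also have "\<dots> \<le> frac_maximal n \<alpha> g y"
        unfolding frac_maximal_eq w_def using B True by (intro SUP_upper2[of B]) auto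
      finally show ?thesis using True by simp
    qed simp
    then have "lp_norm n q (\<lambda>y. ennreal (t / w) * indicator B y) \<le> lp_norm n q (frac_maximal n \<alpha> g)"
      by (intro lp_norm_mono q) auto
    with 1 have "lp_norm n q (\<lambda>y. ennreal (t / w) * indicator B y) \<le> ?T"
      by simp
    moreover have "lp_norm n q (\<lambda>y. ennreal (t / w) * indicator B y) = ennreal (x / w) * ennreal t"
      using lp_norm_scale[of "t / w" n q "indicator B"] t w x
      by (simp flip: ennreal_mult)
    ultimately show ?thesis by simp
  qed
  have cancel: "ennreal (w / x) * (ennreal (x / w) * y) = y" for y
    using x w by (simp flip: mult.assoc ennreal_mult)
  have cancel': "ennreal (x / w) * (ennreal (w / x) * y) = y" for y
    using x w by (simp flip: mult.assoc ennreal_mult)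
  have "?Y \<le> ennreal (w / x) * ?T"
  proof (rule dense_le)
    fix s assume s: "s < ?Y"
    show "s \<le> ennreal (w / x) * ?T"
    proof (cases s)
      case (real t)
      show ?thesis
      proof (cases "t = 0")
        case False
        then have "ennreal (x / w) * s \<le> ?T"
          using test[of t] s real by simp
        then have "ennreal (w / x) * (ennreal (x / w) * s) \<le> ennreal (w / x) * ?T"
          by (rule mult_left_mono) simp
        then show ?thesis by (simp only: cancel)
      qed (simp add: real)
    qed (use s in simp)
  qed
  then have "ennreal (x / w) * ?Y \<le> ennreal (x / w) * (ennreal (w / x) * ?T)"
    by (rule mult_left_mono) simp
  also have "\<dots> = ?T" by (rule cancel')
  finally have "ennreal (x / w) * ?Y \<le> ?T" .
  moreover have "ennreal x * ?Y / ennreal w = ennreal (x / w) * ?Y"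
    using x w by (simp add: ennreal_divide_times ennreal_times_divide flip: divide_ennreal)
  ultimately show "lp_norm n q (indicator B) * ?Y / ennreal (measure (leb n) B powr (1 - avg n \<alpha> B)) \<le> ?T"
    by (simp add: x(2) w_def)
qed

text \<open>
  If the norm of the fractional maximal function of \<open>f\<close> were larger than claimed, a dual function \<open>g\<close>
  would contradict the bilinear estimate. To apply the latter, \<open>f\<close> and \<open>g\<close> are multiplied by \<open>a\<close> and \<open>b\<close>, chosen such
  that the bounds of the maximal operator give their maximal functions the required
  modulars. The factors \<open>2\<close> in \<open>a\<close> and \<open>b\<close> make a norm strictly smaller than its target,
  so that the modular is at most \<open>1\<close> without discussing whether the infimum in the norm is attained.
\<close>

lemma op_norm_frac_maximal_le:
  assumes n: "n \<ge> 1"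
    and p: "p \<in> exponents n" "proper_exponent n p" and q: "q \<in> exponents n" "proper_exponent n q"
    and pq: "AE x in leb n. p x \<le> q x"
    and \<alpha>: "\<alpha> \<in> borel_measurable (leb n)" "\<And>x. x \<in> space (leb n) \<Longrightarrow> \<alpha> x \<le> 1"
    and K: "0 < K" "A_frac_const n p q \<alpha> \<le> ennreal K"
    and A: "0 < A" "A_const n (\<lambda>x. 1 / \<alpha> x) \<le> ennreal A"
    and Np: "0 < Np" "op_norm n p p (maximal n) \<le> ennreal Np"
    and Nq: "0 < Nq" "op_norm n (conj_exp q) (conj_exp q) (maximal n) \<le> ennreal Nq"
  shows "op_norm n p q (frac_maximal n \<alpha>)
    \<le> ennreal (40 * (doubling n)\<^sup>2 * bilinear_const n * K * A * Nq * Np)"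
proof -
  define D where "D = doubling n"
  have D: "1 \<le> D" using n by (simp add: D_def doubling_ge_1)
  define c0 where "c0 = bilinear_const n"
  have c0: "0 < c0" using D by (simp add: c0_def bilinear_const_def D_def)
  define R where "R = 40 * D\<^sup>2 * c0 * K * A * Nq * Np"
  have R: "0 < R" using D c0 K A Np Nq by (simp add: R_def)
  note q' = proper_exponent_conj[OF q(2)]
  have main: "lp_norm n q (frac_maximal n \<alpha> f) \<le> ennreal R * ennreal t"
    if f: "f \<in> borel_measurable (leb n)" and t: "0 < t" "lp_norm n p (\<lambda>x. ennreal \<bar>f x\<bar>) \<le> ennreal t" for f t
  proof -
    note [measurable] = f
    define L where "L = R * t"
    have L: "0 < L" using R t by (simp add: L_def)
    have "lp_norm n q (frac_maximal n \<alpha> f) \<le> ennreal L"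
    proof (rule lp_norm_le[OF L], rule ccontr)
      assume "\<not> modular n q (\<lambda>x. frac_maximal n \<alpha> f x / ennreal L) \<le> 1"
      then have "1 < modular n q (\<lambda>x. frac_maximal n \<alpha> f x / ennreal L)"
        by simp
      then obtain g :: "(nat \<Rightarrow> real) \<Rightarrow> real" where g: "g \<in> borel_measurable (leb n)" "\<And>x. 0 \<le> g x"
        "modular n (conj_exp q) (\<lambda>x. ennreal (g x)) \<le> 1"
        "ennreal L \<le> (\<integral>\<^sup>+x. frac_maximal n \<alpha> f x * ennreal (g x) \<partial>leb n)"
        by (rule dual_witness[OF q(2) frac_maximal_measurable n L]) (auto intro: that)
      note [measurable] = g(1)
      define a where "a = 1 / (8 * D\<^sup>2) * (1 / (2 * Np * t))"
      define b where "b = 1 / (2 * Nq)"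
      have ab: "0 < a" "0 < b" using D Np Nq t by (auto simp: a_def b_def)
      have "lp_norm n p (maximal n f) \<le> op_norm n p p (maximal n) * ennreal t"
        using f t by (intro op_normD) auto
      also have "\<dots> \<le> ennreal Np * ennreal t"
        using Np(2) by (rule mult_right_mono) simp
      also have "\<dots> < ennreal (2 * Np * t)"
        using Np t by (simp add: ennreal_less_iff flip: ennreal_mult)
      finally have Mf: "modular n p (\<lambda>x. maximal n f x / ennreal (2 * Np * t)) \<le> 1"
        by (intro modular_le_1 p) auto
      have F: "modular n p (maximal n (\<lambda>x. a * f x)) \<le> ennreal (1 / (8 * (doubling n)\<^sup>2))"
      proof -
        have "maximal n (\<lambda>x. a * f x) = (\<lambda>x. ennreal (1 / (8 * D\<^sup>2)) * (maximal n f x / ennreal (2 * Np * t)))"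
        proof
          fix x
          have "ennreal a = ennreal (1 / (8 * D\<^sup>2)) * inverse (ennreal (2 * Np * t))"
            using Np t by (simp add: a_def inverse_ennreal inverse_eq_divide flip: ennreal_mult)
          then show "maximal n (\<lambda>x. a * f x) x
              = ennreal (1 / (8 * D\<^sup>2)) * (maximal n f x / ennreal (2 * Np * t))"
            using ab by (simp add: maximal_scale divide_ennreal_def ac_simps)
        qed
        then have "modular n p (maximal n (\<lambda>x. a * f x))
            = modular n p (\<lambda>x. ennreal (1 / (8 * D\<^sup>2)) * (maximal n f x / ennreal (2 * Np * t)))"
          by simp
        also have "\<dots> \<le> ennreal (1 / (8 * D\<^sup>2)) * modular n p (\<lambda>x. maximal n f x / ennreal (2 * Np * t))"
        proof (rule modular_contract[OF p(2)])
          have "1 \<le> 8 * D\<^sup>2" using one_le_power[OF D, of 2] by linarith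
          then show "1 / (8 * D\<^sup>2) \<le> 1"
            by (intro divide_le_eq_1_pos[THEN iffD2]) linarith+
          show "0 < 1 / (8 * D\<^sup>2)" using D by simp
        qed measurable
        also have "\<dots> \<le> ennreal (1 / (8 * D\<^sup>2)) * 1"
          using Mf by (rule mult_left_mono) simp
        finally show ?thesis by (simp add: D_def)
      qed
      have G: "modular n (conj_exp q) (maximal n (\<lambda>x. b * g x)) \<le> 1"
      proof -
        have "lp_norm n (conj_exp q) (\<lambda>x. ennreal \<bar>g x\<bar>) \<le> ennreal 1"
          using g(2,3) by (intro lp_norm_le) auto
        then have "lp_norm n (conj_exp q) (maximal n g) \<le> op_norm n (conj_exp q) (conj_exp q) (maximal n) * ennreal 1"
          by (intro op_normD) auto
        also have "\<dots> \<le> ennreal Nq"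
          using Nq(2) by simp
        also have "\<dots> < ennreal (2 * Nq)"
          using Nq by (simp add: ennreal_less_iff)
        finally have "modular n (conj_exp q) (\<lambda>x. maximal n g x / ennreal (2 * Nq)) \<le> 1"
          by (intro modular_le_1 q') auto
        moreover have "maximal n (\<lambda>x. b * g x) = (\<lambda>x. maximal n g x / ennreal (2 * Nq))"
        proof
          fix x
          have "ennreal b = inverse (ennreal (2 * Nq))"
            using Nq by (simp add: b_def inverse_ennreal inverse_eq_divide)
          then show "maximal n (\<lambda>x. b * g x) x = maximal n g x / ennreal (2 * Nq)"
            using ab by (simp add: maximal_scale divide_ennreal_def mult.commute)
        qed
        ultimately show ?thesis by simp
      qed
      have "(\<integral>\<^sup>+x. frac_maximal n \<alpha> (\<lambda>x. a * f x) x * ennreal \<bar>b * g x\<bar> \<partial>leb n)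
          \<le> ennreal (bilinear_const n * K * A)"
        by (rule bilinear_estimate[OF n p q pq \<alpha> K A _ _ F G]) measurable
      also have "(\<integral>\<^sup>+x. frac_maximal n \<alpha> (\<lambda>x. a * f x) x * ennreal \<bar>b * g x\<bar> \<partial>leb n)
          = (\<integral>\<^sup>+x. ennreal (a * b) * (frac_maximal n \<alpha> f x * ennreal (g x)) \<partial>leb n)"
        using ab g(2) by (intro nn_integral_cong) (simp add: frac_maximal_scale ennreal_mult ac_simps)
      also have "\<dots> = ennreal (a * b) * (\<integral>\<^sup>+x. frac_maximal n \<alpha> f x * ennreal (g x) \<partial>leb n)"
        by (intro nn_integral_cmult) measurable
      finally have "ennreal (a * b) * (\<integral>\<^sup>+x. frac_maximal n \<alpha> f x * ennreal (g x) \<partial>leb n)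
          \<le> ennreal (bilinear_const n * K * A)" .
      moreover have "ennreal (a * b) * ennreal L
          \<le> ennreal (a * b) * (\<integral>\<^sup>+x. frac_maximal n \<alpha> f x * ennreal (g x) \<partial>leb n)"
        using g(4) by (rule mult_left_mono) simp
      ultimately have "ennreal (a * b * L) \<le> ennreal (c0 * K * A)"
        using ab L by (simp add: ennreal_mult c0_def)
      then have le: "a * b * L \<le> c0 * K * A"
        using c0 K A by (subst (asm) ennreal_le_iff) auto
      have "a * b * L = 40 / 32 * (c0 * K * A)"
        using D Np Nq t by (simp add: a_def b_def L_def R_def field_simps power2_eq_square)
      moreover have "0 < c0 * K * A"
        using c0 K A by simp
      ultimately show False
        using le by linarith
    qed
    then show ?thesis
      using R t by (simp add: L_def ennreal_mult)
  qed
  have "lp_norm n q (frac_maximal n \<alpha> f) \<le> ennreal R * lp_norm n p (\<lambda>x. ennreal \<bar>f x\<bar>)"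
    if f: "f \<in> lp_space n p" for f
  proof -
    have fm: "f \<in> borel_measurable (leb n)" using f by (simp add: lp_space_def)
    have cancel: "ennreal (1 / R) * (ennreal R * y) = y" "ennreal R * (ennreal (1 / R) * y) = y" for y
      using R by (simp_all flip: mult.assoc ennreal_mult)
    have "ennreal (1 / R) * lp_norm n q (frac_maximal n \<alpha> f) \<le> lp_norm n p (\<lambda>x. ennreal \<bar>f x\<bar>)"
    proof (rule dense_ge)
      fix s assume s: "lp_norm n p (\<lambda>x. ennreal \<bar>f x\<bar>) < s"
      show "ennreal (1 / R) * lp_norm n q (frac_maximal n \<alpha> f) \<le> s"
      proof (cases s)
        case (real t)
        with s have "0 < t"
          by (cases "t = 0") auto
        then have "lp_norm n q (frac_maximal n \<alpha> f) \<le> ennreal R * s"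
          using main[OF fm, of t] s real by (simp add: less_imp_le)
        then have "ennreal (1 / R) * lp_norm n q (frac_maximal n \<alpha> f) \<le> ennreal (1 / R) * (ennreal R * s)"
          by (rule mult_left_mono) simp
        then show ?thesis by (simp only: cancel)
      qed simp
    qed
    then have "ennreal R * (ennreal (1 / R) * lp_norm n q (frac_maximal n \<alpha> f))
        \<le> ennreal R * lp_norm n p (\<lambda>x. ennreal \<bar>f x\<bar>)"
      by (rule mult_left_mono) simp
    then show ?thesis by (simp only: cancel)
  qed
  then have "op_norm n p q (frac_maximal n \<alpha>) \<le> ennreal R"
    unfolding op_norm_def by (intro Inf_lower) auto
  then show ?thesis
    by (simp add: R_def D_def c0_def)
qed

text \<open>
  The bound just proved is linear in the Muckenhoupt constant \<open>A\<close> of \<open>1 / \<alpha>\<close>; since \<open>A \<ge> 1 / 4\<close>, it is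
  at most \<open>16 * A ^ 3\<close>, which turns the factor \<open>40\<close> into \<open>640\<close>.
\<close>

definition upper_const :: "nat \<Rightarrow> real" where
  "upper_const n = 640 * (doubling n)\<^sup>2 * bilinear_const n"

lemma op_norm_frac_maximal_le_product:
  assumes n: "n \<ge> 1"
    and p: "p \<in> exponents n" "proper_exponent n p" and q: "q \<in> exponents n" "proper_exponent n q"
    and pq: "AE x in leb n. p x \<le> q x"
    and \<alpha>: "\<alpha> \<in> borel_measurable (leb n)" "\<And>x. x \<in> space (leb n) \<Longrightarrow> \<alpha> x \<le> 1"
  shows "op_norm n p q (frac_maximal n \<alpha>)
    \<le> ennreal (upper_const n) * A_frac_const n p q \<alpha> * (A_const n (\<lambda>x. 1 / \<alpha> x)) ^ 3
       * op_norm n (conj_exp q) (conj_exp q) (maximal n) * op_norm n p p (maximal n)"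
    (is "?T \<le> ennreal _ * ?K * ?A ^ 3 * ?Nq * ?Np")
proof -
  have D: "1 \<le> doubling n" using n by (rule doubling_ge_1)
  have C: "0 < upper_const n"
    using D by (simp add: upper_const_def bilinear_const_def)
  have pos: "0 < ?K" "0 < ?A" "0 < ?Nq" "0 < ?Np"
    using A_frac_const_pos[OF n p(1) q(1)] less_le_trans[OF _ A_const_ge[OF n \<alpha>], of 0]
      op_norm_maximal_pos[OF n conj_exp_exponents[OF q(1)] proper_exponent_conj[OF q(2)]]
      op_norm_maximal_pos[OF n p] by auto
  show ?thesis
  proof (cases "?K = top \<or> ?A = top \<or> ?Nq = top \<or> ?Np = top")
    case True
    then have "ennreal (upper_const n) * ?K * ?A ^ 3 * ?Nq * ?Np = top"
      using pos C by (auto simp: ennreal_mult_eq_top_iff zero_less_iff_neq_zero power_eq_top_ennreal)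
    then show ?thesis by (simp only: top_greatest)
  next
    case False
    then obtain K A Nq Np where r: "?K = ennreal K" "?A = ennreal A" "?Nq = ennreal Nq" "?Np = ennreal Np"
      and r0: "0 \<le> K" "0 \<le> A" "0 \<le> Nq" "0 \<le> Np"
      by (metis ennreal_cases)
    have rp: "0 < K" "0 < A" "0 < Nq" "0 < Np"
      using pos unfolding r by simp_all
    have "1 / 4 \<le> A"
      using A_const_ge[OF n \<alpha>] r0 unfolding r by (simp add: ennreal_le_iff)
    then have "(1 / 4) ^ 2 \<le> A ^ 2"
      by (intro power_mono) auto
    then have "A * (1 / 16) \<le> A * A ^ 2"
      using rp by (intro mult_left_mono) (auto simp: power2_eq_square)
    then have A3: "A \<le> 16 * A ^ 3"
      by (simp add: power2_eq_square power3_eq_cube)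
    have "?T \<le> ennreal (40 * (doubling n)\<^sup>2 * bilinear_const n * K * A * Nq * Np)"
      by (rule op_norm_frac_maximal_le[OF n p q pq \<alpha>]) (use r rp in auto)
    also have "\<dots> \<le> ennreal (40 * (doubling n)\<^sup>2 * bilinear_const n * K * (16 * A ^ 3) * Nq * Np)"
      using A3 rp D by (intro ennreal_leI mult_right_mono mult_left_mono) (auto simp: bilinear_const_def)
    also have "\<dots> = ennreal (upper_const n * K * A ^ 3 * Nq * Np)"
      by (simp add: upper_const_def algebra_simps)
    also have "\<dots> = ennreal (upper_const n) * ?K * ?A ^ 3 * ?Nq * ?Np"
      unfolding r using C rp by (simp add: ennreal_mult ennreal_power)
    finally show ?thesis .
  qed
qed

theorem theorem1p1:
  shows "\<exists>(C :: real) > 0. \<exists>Cn :: nat \<Rightarrow> real. \<forall>n \<ge> 1. Cn n > 0 \<and>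
    (\<forall>(p :: (nat \<Rightarrow> real) \<Rightarrow> ennreal) (q :: (nat \<Rightarrow> real) \<Rightarrow> ennreal) (\<alpha> :: (nat \<Rightarrow> real) \<Rightarrow> ennreal).
      p \<in> exponents n \<longrightarrow> q \<in> exponents n \<longrightarrow> (\<lambda>x. 1 / \<alpha> x) \<in> exponents n \<longrightarrow>
      (AE x in leb n. 1 < p x \<and> p x \<le> q x \<and> q x < \<infinity>) \<longrightarrow>
        A_frac_const n p q \<alpha> \<le> ennreal C * op_norm n p q (frac_maximal n \<alpha>) \<and>
        op_norm n p q (frac_maximal n \<alpha>)
          \<le> ennreal (Cn n) * A_frac_const n p q \<alpha> * (A_const n (\<lambda>x. 1 / \<alpha> x)) ^ 3
             * op_norm n (conj_exp q) (conj_exp q) (maximal n) * op_norm n p p (maximal n))"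
proof (intro exI[of _ 1] exI[of _ upper_const] conjI allI impI)
  fix n :: nat assume n: "n \<ge> 1"
  show "0 < upper_const n"
    using doubling_ge_1[OF n] by (simp add: upper_const_def bilinear_const_def)
  fix p q \<alpha> :: "(nat \<Rightarrow> real) \<Rightarrow> ennreal"
  assume p: "p \<in> exponents n" and q: "q \<in> exponents n" and \<alpha>: "(\<lambda>x. 1 / \<alpha> x) \<in> exponents n"
    and pq: "AE x in leb n. 1 < p x \<and> p x \<le> q x \<and> q x < \<infinity>"
  have "AE x in leb n. 1 < p x \<and> p x < \<infinity>"
    using pq by (rule eventually_mono) (auto intro: le_less_trans)
  then have p': "proper_exponent n p"
    using p by (simp add: proper_exponent_def exponents_def)
  have "AE x in leb n. 1 < q x \<and> q x < \<infinity>"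
    using pq by (rule eventually_mono) (auto intro: less_le_trans)
  then have q': "proper_exponent n q"
    using q by (simp add: proper_exponent_def exponents_def)
  have pq': "AE x in leb n. p x \<le> q x"
    using pq by (rule eventually_mono) auto
  have "(\<lambda>x. 1 / \<alpha> x) \<in> borel_measurable (leb n)"
    using \<alpha> by (simp add: exponents_def)
  then have "(\<lambda>x. 1 / (1 / \<alpha> x)) \<in> borel_measurable (leb n)"
    by measurable
  then have \<alpha>_meas: "\<alpha> \<in> borel_measurable (leb n)"
    unfolding one_divide_one_divide_ennreal .
  have \<alpha>_le: "\<alpha> x \<le> 1" if "x \<in> space (leb n)" for x
  proof -
    have "1 \<le> 1 / \<alpha> x" using \<alpha> that by (simp add: exponents_def)
    then have "1 / (1 / \<alpha> x) \<le> 1"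
      by (intro divide_le_posI_ennreal) (auto simp: less_le_trans[OF zero_less_one])
    then show ?thesis by simp
  qed
  show "A_frac_const n p q \<alpha> \<le> ennreal 1 * op_norm n p q (frac_maximal n \<alpha>)"
    using A_frac_const_le_op_norm[OF n p p' q q'] by simp
  show "op_norm n p q (frac_maximal n \<alpha>)
      \<le> ennreal (upper_const n) * A_frac_const n p q \<alpha> * (A_const n (\<lambda>x. 1 / \<alpha> x)) ^ 3
         * op_norm n (conj_exp q) (conj_exp q) (maximal n) * op_norm n p p (maximal n)"
    by (rule op_norm_frac_maximal_le_product[OF n p p' q q' pq' \<alpha>_meas \<alpha>_le])
qed simp

end
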